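(* Let $q$ be a prime power, let $H$ be a normalized generalized Hadamard matrix $\mathrm{GH}(q,v/q)$ of order $v$ over the additive group of $\mathbb{F}_q$, let $K$ be a multiplicative group and $\phi:\mathbb{F}_q\to K$ an isomorphism from the additive group of $\mathbb{F}_q$ onto $K$. Let $Z=\{(kI,kI):k\in K\}\subseteq\mathrm{Aut}(\phi(H))$ and let $\Theta:\mathrm{Aut}(\phi(H))\to\mathrm{PAut}(\mathcal{E}_{\phi(H)})$ be the isomorphism described in the context. Then $C=C_H$ is a generalized Hadamard full propelinear code (GHFP-code) if and only if there is a subgroup $R\subseteq\mathrm{Aut}(\phi(H))$ with $Z\subseteq R$ such that $\Theta(R)$ is a regular subgroup of $\mathrm{PAut}(\mathcal{E}_{\phi(H)})$, with $\Theta(Z)\subseteq\Theta(R)$.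
   Context: Generalized Hadamard codes. A $v\times v$ matrix $H=(h_{ij})$ over the additive group $\mathbb{F}_q$, $q\mid v$, is a $\mathrm{GH}(q,v/q)$ if for all $i<j$ the multiset $\{h_{ik}-h_{jk}:1\le k\le v\}$ contains each element of $\mathbb{F}_q$ exactly $v/q$ times; it is normalized if its first row and column are zero. $F_H\subseteq\mathbb{F}_q^v$ is the set of rows of $H$ and $C_H=\bigcup_{\alpha\in\mathbb{F}_q}(F_H+\alpha\mathbf 1)$, with $\mathbf 1$ the all-one vector, is called a generalized Hadamard code. $\phi(H)=[\phi(h_{ij})]$. Full propelinear codes. For $\pi\in\mathcal{S}_n$ and $y\in\mathbb{F}_q^n$, $\pi(y)=(y_{\pi^{-1}(1)},\dots,y_{\pi^{-1}(n)})$. A code $C\subseteq\mathbb{F}_q^n$ with $\mathbf 0\in C$ is full propelinear if to every $x\in C$ can be assigned $\pi_x\in\mathcal{S}_n$ such that, writing $x\star y=x+\pi_x(y)$: (i) $x\star C=C$ for all $x\in C$; (ii) $\pi_{x\star y}=\pi_x\circ\pi_y$ for all $x,y\in C$; (iii) $\pi_x$ fixes no coordinate if $x\notin\{\alpha\mathbf 1:\alpha\in\mathbb{F}_q\}$, and $\pi_x=\mathrm{Id}$ if $x=\alpha\mathbf 1$ for some $\alpha\in\mathbb{F}_q$. A GHFP-code is a generalized Hadamard code that is full propelinear. Automorphisms. For a $v\times v$ matrix $M=(m_{ij})$ with entries in $K$, $\mathrm{Aut}(M)$ is the group of pairs $(P,Q)$ of monomial matrices with nonzero entries in $K$ such that $PMQ^*=M$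 (computed over $\mathbb{Z}[K]$), where $Q^*$ is the transpose of $Q$ with each nonzero entry replaced by its inverse; multiplication is $(P,Q)(R,S)=(PR,QS)$. $\mathrm{PAut}(M)$ is the subgroup of pairs of permutation matrices. With $K=\{k_0=1,\dots,k_{q-1}\}$, $\mathcal{E}_M=[k_ik_jM]_{0\le i,j\le q-1}$; its rows and columns are indexed by $K\times\{1,\dots,v\}$, with entry $k\,l\,m_{ij}$ in position $((k,i),(l,j))$. The isomorphism $\Theta:\mathrm{Aut}(M)\to\mathrm{PAut}(\mathcal{E}_M)$ (for $M$ generalized Hadamard): if $P$ has nonzero entries $p_i$ in positions $(i,\alpha(i))$ and $Q$ has nonzero entries $q_j$ in positions $(j,\beta(j))$, then $\Theta(P,Q)=(P',Q')$ where $P'$ is the permutation matrix with ones in positions $((k,i),(kp_i,\alpha(i)))$ and $Q'$ the permutation matrix with ones in positions $((l,j),(lq_j^{-1},\beta(j)))$, for $k,l\in K$. A subgroup of $\mathrm{PAut}(\mathcal{E}_M)$ is regular if its induced actions on the rows and on the columns of $\mathcal{E}_M$ are both regular. *)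

theory Defs
  imports "HOL-Algebra.Group_Action" "HOL-Algebra.Ring" "HOL-Combinatorics.Permutations" "HOL-Number_Theory.Prime_Powers"
begin

section \<open>Matrices over arbitrary index sets\<close>

text \<open>
  A square matrix with row and column index set \<open>I\<close> is an extensional function on \<open>I \<times> I\<close>.
  Ordinary matrices of order \<open>v\<close> have \<open>I = {1..v}\<close>; the expanded matrix below is indexed
  by \<open>carrier K \<times> {1..v}\<close>.
\<close>

definition mats :: "'i set \<Rightarrow> 'b set \<Rightarrow> ('i \<times> 'i \<Rightarrow> 'b) set" where
  "mats I S = (I \<times> I) \<rightarrow>\<^sub>E S"

definition map_mat :: "'i set \<Rightarrow> ('b \<Rightarrow> 'c) \<Rightarrow> ('i \<times> 'i \<Rightarrow> 'b) \<Rightarrow> ('i \<times> 'i \<Rightarrow> 'c)" where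
  "map_mat I f M = (\<lambda>(i, j) \<in> I \<times> I. f (M (i, j)))"

definition mat_mult ::
    "('r, 'm) ring_scheme \<Rightarrow> 'i set \<Rightarrow> ('i \<times> 'i \<Rightarrow> 'r) \<Rightarrow> ('i \<times> 'i \<Rightarrow> 'r) \<Rightarrow> ('i \<times> 'i \<Rightarrow> 'r)" where
  "mat_mult R I A B = (\<lambda>(i, j) \<in> I \<times> I. \<Oplus>\<^bsub>R\<^esub> l \<in> I. A (i, l) \<otimes>\<^bsub>R\<^esub> B (l, j))"

definition scalar_mat ::
    "('r, 'm) ring_scheme \<Rightarrow> 'i set \<Rightarrow> 'r \<Rightarrow> ('i \<times> 'i \<Rightarrow> 'r)" where
  "scalar_mat R I c = (\<lambda>(i, j) \<in> I \<times> I. if i = j then c else \<zero>\<^bsub>R\<^esub>)"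


section \<open>Generalized Hadamard matrices and codes\<close>

definition gen_hadamard ::
    "('a, 'm) ring_scheme \<Rightarrow> nat \<Rightarrow> (nat \<times> nat \<Rightarrow> 'a) \<Rightarrow> bool" where
  "gen_hadamard F v H \<longleftrightarrow>
     0 < v \<and> order F dvd v \<and> H \<in> mats {1..v} (carrier F) \<and>
     (\<forall>i\<in>{1..v}. \<forall>j\<in>{1..v}. i < j \<longrightarrow>
        (\<forall>a\<in>carrier F. card {k \<in> {1..v}. H (i, k) \<ominus>\<^bsub>F\<^esub> H (j, k) = a} = v div order F))"

definition normalized ::
    "('a, 'm) ring_scheme \<Rightarrow> nat \<Rightarrow> (nat \<times> nat \<Rightarrow> 'a) \<Rightarrow> bool" where
  "normalized F v H \<longleftrightarrow> (\<forall>i\<in>{1..v}. H (1, i) = \<zero>\<^bsub>F\<^esub> \<and> H (i, 1) = \<zero>\<^bsub>F\<^esub>)"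

text \<open>Words of length \<open>n\<close> over \<open>F\<close> are extensional functions on \<open>{1..n}\<close>.\<close>

definition words :: "('a, 'm) ring_scheme \<Rightarrow> nat \<Rightarrow> (nat \<Rightarrow> 'a) set" where
  "words F n = {1..n} \<rightarrow>\<^sub>E carrier F"

definition word_add ::
    "('a, 'm) ring_scheme \<Rightarrow> nat \<Rightarrow> (nat \<Rightarrow> 'a) \<Rightarrow> (nat \<Rightarrow> 'a) \<Rightarrow> (nat \<Rightarrow> 'a)" where
  "word_add F n x y = (\<lambda>i\<in>{1..n}. x i \<oplus>\<^bsub>F\<^esub> y i)"

definition const_word :: "nat \<Rightarrow> 'a \<Rightarrow> (nat \<Rightarrow> 'a)" where
  "const_word n c = (\<lambda>i\<in>{1..n}. c)"

definition const_words :: "('a, 'm) ring_scheme \<Rightarrow> nat \<Rightarrow> (nat \<Rightarrow> 'a) set" where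
  "const_words F n = const_word n ` carrier F"

definition mat_rows :: "nat \<Rightarrow> (nat \<times> nat \<Rightarrow> 'a) \<Rightarrow> (nat \<Rightarrow> 'a) set" where
  "mat_rows v H = (\<lambda>i. \<lambda>j\<in>{1..v}. H (i, j)) ` {1..v}"

definition gh_code ::
    "('a, 'm) ring_scheme \<Rightarrow> nat \<Rightarrow> (nat \<times> nat \<Rightarrow> 'a) \<Rightarrow> (nat \<Rightarrow> 'a) set" where
  "gh_code F v H =
     (\<Union>c\<in>carrier F. (\<lambda>x. word_add F v x (const_word v c)) ` mat_rows v H)"


section \<open>Full propelinear codes\<close>

definition permute_word :: "nat \<Rightarrow> (nat \<Rightarrow> nat) \<Rightarrow> (nat \<Rightarrow> 'a) \<Rightarrow> (nat \<Rightarrow> 'a)" where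
  "permute_word n p y = (\<lambda>i\<in>{1..n}. y (inv_into UNIV p i))"

definition star ::
    "('a, 'm) ring_scheme \<Rightarrow> nat \<Rightarrow> ((nat \<Rightarrow> 'a) \<Rightarrow> nat \<Rightarrow> nat) \<Rightarrow>
     (nat \<Rightarrow> 'a) \<Rightarrow> (nat \<Rightarrow> 'a) \<Rightarrow> (nat \<Rightarrow> 'a)" where
  "star F n \<pi> x y = word_add F n x (permute_word n (\<pi> x) y)"

definition full_propelinear ::
    "('a, 'm) ring_scheme \<Rightarrow> nat \<Rightarrow> (nat \<Rightarrow> 'a) set \<Rightarrow> bool" where
  "full_propelinear F n C \<longleftrightarrow>
     C \<subseteq> words F n \<and> const_word n \<zero>\<^bsub>F\<^esub> \<in> C \<and>
     (\<exists>\<pi>. (\<forall>x\<in>C. \<pi> x permutes {1..n}) \<and>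
          (\<forall>x\<in>C. star F n \<pi> x ` C = C) \<and>
          (\<forall>x\<in>C. \<forall>y\<in>C. \<pi> (star F n \<pi> x y) = \<pi> x \<circ> \<pi> y) \<and>
          (\<forall>x\<in>C. if x \<in> const_words F n then \<pi> x = id
                 else (\<forall>i\<in>{1..n}. \<pi> x i \<noteq> i)))"

definition GHFP_code ::
    "('a, 'm) ring_scheme \<Rightarrow> nat \<Rightarrow> (nat \<Rightarrow> 'a) set \<Rightarrow> bool" where
  "GHFP_code F v C \<longleftrightarrow>
     (\<exists>H. gen_hadamard F v H \<and> C = gh_code F v H) \<and> full_propelinear F v C"


section \<open>The integral group ring\<close>

text \<open>
  Elements of \<open>\<int>[K]\<close> are the finitely supported functions from \<open>carrier K\<close> to the integers,
  extended by 0 outside \<open>carrier K\<close>; \<open>single k\<close> is the basis element belonging to \<open>k\<close>.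
\<close>

definition group_ring :: "('k, 'n) monoid_scheme \<Rightarrow> ('k \<Rightarrow> int) ring" where
  "group_ring K =
     \<lparr>carrier = {f. finite {x. f x \<noteq> 0} \<and> {x. f x \<noteq> 0} \<subseteq> carrier K},
      monoid.mult = (\<lambda>f g x. \<Sum>(a, b) \<in> {(a, b). f a \<noteq> 0 \<and> g b \<noteq> 0 \<and> a \<otimes>\<^bsub>K\<^esub> b = x}. f a * g b),
      one = (\<lambda>x. if x = \<one>\<^bsub>K\<^esub> then 1 else 0),
      zero = (\<lambda>x. 0),
      add = (\<lambda>f g x. f x + g x)\<rparr>"

definition single :: "'k \<Rightarrow> ('k \<Rightarrow> int)" where
  "single k = (\<lambda>x. if x = k then 1 else 0)"


section \<open>Monomial matrices and automorphism groups\<close>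

definition monomial ::
    "('k, 'n) monoid_scheme \<Rightarrow> 'i set \<Rightarrow> ('i \<times> 'i \<Rightarrow> 'k \<Rightarrow> int) \<Rightarrow> bool" where
  "monomial K I P \<longleftrightarrow>
     P \<in> mats I (insert \<zero>\<^bsub>group_ring K\<^esub> (single ` carrier K)) \<and>
     (\<forall>i\<in>I. \<exists>!j. j \<in> I \<and> P (i, j) \<noteq> \<zero>\<^bsub>group_ring K\<^esub>) \<and>
     (\<forall>j\<in>I. \<exists>!i. i \<in> I \<and> P (i, j) \<noteq> \<zero>\<^bsub>group_ring K\<^esub>)"

definition perm_mat ::
    "('k, 'n) monoid_scheme \<Rightarrow> 'i set \<Rightarrow> ('i \<times> 'i \<Rightarrow> 'k \<Rightarrow> int) \<Rightarrow> bool" where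
  "perm_mat K I P \<longleftrightarrow>
     monomial K I P \<and> P \<in> mats I {\<zero>\<^bsub>group_ring K\<^esub>, \<one>\<^bsub>group_ring K\<^esub>}"

definition star_transpose ::
    "('k, 'n) monoid_scheme \<Rightarrow> 'i set \<Rightarrow> ('i \<times> 'i \<Rightarrow> 'k \<Rightarrow> int) \<Rightarrow> ('i \<times> 'i \<Rightarrow> 'k \<Rightarrow> int)" where
  "star_transpose K I Q =
     (\<lambda>(i, j) \<in> I \<times> I. if Q (j, i) = \<zero>\<^bsub>group_ring K\<^esub> then \<zero>\<^bsub>group_ring K\<^esub>
                         else inv\<^bsub>group_ring K\<^esub> Q (j, i))"

text \<open>\<open>M\<close> has entries in \<open>K\<close>; it is mapped into \<open>\<int>[K]\<close> before multiplying.\<close>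

definition Aut ::
    "('k, 'n) monoid_scheme \<Rightarrow> 'i set \<Rightarrow> ('i \<times> 'i \<Rightarrow> 'k) \<Rightarrow>
     (('i \<times> 'i \<Rightarrow> 'k \<Rightarrow> int) \<times> ('i \<times> 'i \<Rightarrow> 'k \<Rightarrow> int)) monoid" where
  "Aut K I M =
     \<lparr>carrier = {(P, Q). monomial K I P \<and> monomial K I Q \<and>
                  mat_mult (group_ring K) I
                    (mat_mult (group_ring K) I P (map_mat I single M))
                    (star_transpose K I Q) = map_mat I single M},
      monoid.mult = (\<lambda>(P, Q) (R, S). (mat_mult (group_ring K) I P R, mat_mult (group_ring K) I Q S)),
      one = (scalar_mat (group_ring K) I \<one>\<^bsub>group_ring K\<^esub>,
             scalar_mat (group_ring K) I \<one>\<^bsub>group_ring K\<^esub>)\<rparr>"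

definition PAut ::
    "('k, 'n) monoid_scheme \<Rightarrow> 'i set \<Rightarrow> ('i \<times> 'i \<Rightarrow> 'k) \<Rightarrow>
     (('i \<times> 'i \<Rightarrow> 'k \<Rightarrow> int) \<times> ('i \<times> 'i \<Rightarrow> 'k \<Rightarrow> int)) monoid" where
  "PAut K I M =
     (Aut K I M)\<lparr>carrier := {(P, Q) \<in> carrier (Aut K I M). perm_mat K I P \<and> perm_mat K I Q}\<rparr>"

definition scalar_pairs ::
    "('k, 'n) monoid_scheme \<Rightarrow> 'i set \<Rightarrow>
     (('i \<times> 'i \<Rightarrow> 'k \<Rightarrow> int) \<times> ('i \<times> 'i \<Rightarrow> 'k \<Rightarrow> int)) set" where
  "scalar_pairs K I =
     (\<lambda>k. (scalar_mat (group_ring K) I (single k), scalar_mat (group_ring K) I (single k)))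
       ` carrier K"


section \<open>The expanded matrix and regular subgroups\<close>

definition expanded_mat ::
    "('k, 'n) monoid_scheme \<Rightarrow> 'i set \<Rightarrow> ('i \<times> 'i \<Rightarrow> 'k) \<Rightarrow>
     (('k \<times> 'i) \<times> ('k \<times> 'i) \<Rightarrow> 'k)" where
  "expanded_mat K I M =
     (\<lambda>((k, i), (l, j)) \<in> (carrier K \<times> I) \<times> (carrier K \<times> I). k \<otimes>\<^bsub>K\<^esub> l \<otimes>\<^bsub>K\<^esub> M (i, j))"

text \<open>
  For monomial \<open>P\<close> the conditions \<open>P (i, i') = single p\<close> and \<open>Q (j, j') = single r\<close> say that
  the nonzero entry of row \<open>i\<close> of \<open>P\<close> is \<open>p\<close>, in column \<open>i'\<close>, and the nonzero entry of row \<open>j\<close>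
  of \<open>Q\<close> is \<open>r\<close>, in column \<open>j'\<close>.
\<close>

definition Theta ::
    "('k, 'n) monoid_scheme \<Rightarrow> 'i set \<Rightarrow>
     ('i \<times> 'i \<Rightarrow> 'k \<Rightarrow> int) \<times> ('i \<times> 'i \<Rightarrow> 'k \<Rightarrow> int) \<Rightarrow>
     (('k \<times> 'i) \<times> ('k \<times> 'i) \<Rightarrow> 'k \<Rightarrow> int) \<times> (('k \<times> 'i) \<times> ('k \<times> 'i) \<Rightarrow> 'k \<Rightarrow> int)" where
  "Theta K I = (\<lambda>(P, Q).
     ((\<lambda>((k, i), (k', i')) \<in> (carrier K \<times> I) \<times> (carrier K \<times> I).
         if \<exists>p\<in>carrier K. P (i, i') = single p \<and> k' = k \<otimes>\<^bsub>K\<^esub> p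
         then \<one>\<^bsub>group_ring K\<^esub> else \<zero>\<^bsub>group_ring K\<^esub>),
      (\<lambda>((l, j), (l', j')) \<in> (carrier K \<times> I) \<times> (carrier K \<times> I).
         if \<exists>r\<in>carrier K. Q (j, j') = single r \<and> l' = l \<otimes>\<^bsub>K\<^esub> inv\<^bsub>K\<^esub> r
         then \<one>\<^bsub>group_ring K\<^esub> else \<zero>\<^bsub>group_ring K\<^esub>)))"

text \<open>
  Row \<open>i\<close> of \<open>M\<close> becomes row \<open>perm_of K I P i\<close> of \<open>P M\<close>, and column \<open>j\<close> of \<open>M\<close> becomes column
  \<open>perm_of K I Q j\<close> of the product of \<open>M\<close> with the transpose of \<open>Q\<close>. With this orientation both
  induced actions are left actions.
\<close>

definition perm_of ::
    "('k, 'n) monoid_scheme \<Rightarrow> 'i set \<Rightarrow> ('i \<times> 'i \<Rightarrow> 'k \<Rightarrow> int) \<Rightarrow> 'i \<Rightarrow> 'i" where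
  "perm_of K I P = (\<lambda>i\<in>I. THE i'. i' \<in> I \<and> P (i', i) \<noteq> \<zero>\<^bsub>group_ring K\<^esub>)"

definition regular_action ::
    "('g, 'n) monoid_scheme \<Rightarrow> 'e set \<Rightarrow> ('g \<Rightarrow> 'e \<Rightarrow> 'e) \<Rightarrow> bool" where
  "regular_action G E \<rho> \<longleftrightarrow>
     transitive_action G E \<rho> \<and> (\<forall>x\<in>E. stabilizer G \<rho> x = {\<one>\<^bsub>G\<^esub>})"

definition regular_subgroup ::
    "('k, 'n) monoid_scheme \<Rightarrow> 'i set \<Rightarrow> ('i \<times> 'i \<Rightarrow> 'k) \<Rightarrow>
     (('i \<times> 'i \<Rightarrow> 'k \<Rightarrow> int) \<times> ('i \<times> 'i \<Rightarrow> 'k \<Rightarrow> int)) set \<Rightarrow> bool" where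
  "regular_subgroup K I M S \<longleftrightarrow>
     subgroup S (PAut K I M) \<and>
     regular_action ((PAut K I M)\<lparr>carrier := S\<rparr>) I (\<lambda>(P, Q). perm_of K I P) \<and>
     regular_action ((PAut K I M)\<lparr>carrier := S\<rparr>) I (\<lambda>(P, Q). perm_of K I Q)"

end

theory Submission
  imports Defs
begin

text \<open>
  Write an automorphism additively as permutations \<open>\<alpha>, \<beta>\<close> of \<open>{1..v}\<close> and words \<open>p, r\<close> with
  \<open>p\<^sub>i + H(\<alpha> i, \<beta> j) = H(i, j) + r\<^sub>j\<close>. The map \<open>y \<mapsto> (y\<^bsub>\<beta> j\<^esub> - r\<^sub>j)\<^sub>j\<close> sends the codeword
  \<open>H\<^bsub>\<alpha> i\<^esub> + a\<^bold>1\<close> to \<open>H\<^sub>i + (a - p\<^sub>i)\<^bold>1\<close>, and this is the action induced through \<open>\<Theta>\<close> on the rows of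
  the expanded matrix, since the rows are indexed by the codewords. Given a regular subgroup, each
  codeword \<open>x\<close> is the image of the zero word under exactly one element, which therefore has the form
  \<open>y \<mapsto> x + \<pi>\<^sub>x(y)\<close>; a coordinate fixed by \<open>\<pi>\<^sub>x\<close> yields a column on which that element agrees with
  an element of \<open>Z\<close>, so \<open>x\<close> is constant. Conversely, the maps \<open>y \<mapsto> x + \<pi>\<^sub>x(y)\<close> of a full
  propelinear structure permute the rows of \<open>H\<close> up to constants, hence come from automorphisms, and
  these form a group that acts freely on rows and on columns and has as many elements as there are
  rows and columns.
\<close>

section \<open>Monomial matrices over the integral group ring\<close>

text \<open>Automorphisms are matrices over the group ring, while the code lives over
  \<open>F\<close>. The bridge is the normal form \<open>mon\<close>, a permutation together with
  the nonzero entries; it turns the matrix equation of \<open>Aut\<close> into an equation in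
  \<open>K\<close>, which is then pulled back along \<phi>. Orders and signs have to be reconciled.
  A product of monomial matrices composes the permutations backwards; \<open>perm_of\<close> and the
  coordinate permutation of a word both pass to inverses, which turns them round again, so \<beta>
  is the inverse of \<open>\<pi> x\<close>. The action on words subtracts r, so the element attached
  to x has r = -x, and a constant word belongs to the scalar pair of its negative. The difference
  condition on \<open>H\<close> enters through one fact: distinct rows never differ by a constant.
  Hence codewords label expanded rows without repetition, a map y \<mapsto> x + \<pi>(y) preserving
  the code permutes the rows of \<open>H\<close> up to constants, and the row matrix of an
  automorphism is determined by its column matrix, so that equality of automorphisms can be tested
  on the column part alone.\<close>

lemma group_ring_zero: "\<zero>\<^bsub>group_ring K\<^esub> = (\<lambda>x. 0)"
  by (simp add: group_ring_def)

lemma group_ring_one: "\<one>\<^bsub>group_ring K\<^esub> = single \<one>\<^bsub>K\<^esub>"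
  by (auto simp: group_ring_def single_def)

lemma single_eq_iff [simp]: "single a = single b \<longleftrightarrow> a = b"
  by (metis single_def zero_neq_one)

lemma single_neq_zero [simp]: "single a \<noteq> \<zero>\<^bsub>group_ring K\<^esub>"
  by (metis single_def zero_neq_one group_ring_zero)

lemmas zero_neq_single [simp] = single_neq_zero [symmetric]

lemma single_in_group_ring: "a \<in> carrier K \<Longrightarrow> single a \<in> carrier (group_ring K)"
  by (simp add: group_ring_def single_def)

lemma zero_in_group_ring: "\<zero>\<^bsub>group_ring K\<^esub> \<in> carrier (group_ring K)"
  by (simp add: group_ring_def)

lemma group_ring_mult_zero [simp]:
  "f \<otimes>\<^bsub>group_ring K\<^esub> \<zero>\<^bsub>group_ring K\<^esub> = \<zero>\<^bsub>group_ring K\<^esub>"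
  "\<zero>\<^bsub>group_ring K\<^esub> \<otimes>\<^bsub>group_ring K\<^esub> f = \<zero>\<^bsub>group_ring K\<^esub>"
  by (simp_all add: group_ring_def)

lemma single_mult_single [simp]:
  "single a \<otimes>\<^bsub>group_ring K\<^esub> single b = single (a \<otimes>\<^bsub>K\<^esub> b)"
proof
  fix x
  have "{(c, d). single a c \<noteq> 0 \<and> single b d \<noteq> 0 \<and> c \<otimes>\<^bsub>K\<^esub> d = x}
      = (if x = a \<otimes>\<^bsub>K\<^esub> b then {(a, b)} else {})"
    by (auto simp: single_def split: if_splits)
  then show "(single a \<otimes>\<^bsub>group_ring K\<^esub> single b) x = single (a \<otimes>\<^bsub>K\<^esub> b) x"
    by (simp add: group_ring_def) (simp add: single_def)
qed

text \<open>The sums in \<open>mat_mult\<close> are taken with \<open>finsum\<close>, whose rules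
  ask for exactly this additive structure.\<close>

lemma abelian_monoid_group_ring: "abelian_monoid (group_ring K)"
proof (rule abelian_monoidI)
  fix f g assume f: "f \<in> carrier (group_ring K)" and g: "g \<in> carrier (group_ring K)"
  have "{x. f x + g x \<noteq> 0} \<subseteq> {x. f x \<noteq> 0} \<union> {x. g x \<noteq> 0}" by auto
  then show "f \<oplus>\<^bsub>group_ring K\<^esub> g \<in> carrier (group_ring K)"
    using f g by (auto simp: group_ring_def intro: finite_subset)
qed (auto simp: group_ring_def)

text \<open>Elements of the group ring vanish off the group, so by cancellation (a, b) is the only
  pair that can contribute to the coefficient at the product of a and b.\<close>

lemma (in group) single_mult_apply:
  assumes "a \<in> carrier G" "b \<in> carrier G" "f \<in> carrier (group_ring G)"
  shows "(single a \<otimes>\<^bsub>group_ring G\<^esub> f) (a \<otimes> b) = f b"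
proof -
  have "{(c, d). single a c \<noteq> 0 \<and> f d \<noteq> 0 \<and> c \<otimes> d = a \<otimes> b} = (if f b = 0 then {} else {(a, b)})"
    using assms by (auto simp: single_def group_ring_def split: if_splits)
  then show ?thesis
    by (simp add: group_ring_def) (simp add: single_def)
qed

text \<open>\<open>inv\<close> is a definite description, so uniqueness has to be checked as well:
  if \<open>single a\<close> times y is the unit, then \<open>y b\<close> is the coefficient of the
  unit at the product of a and b.\<close>

lemma (in group) inv_single:
  assumes a: "a \<in> carrier G"
  shows "inv\<^bsub>group_ring G\<^esub> (single a) = single (inv a)"
  unfolding m_inv_def [of "group_ring G"]
proof (rule the_equality)
  show "single (inv a) \<in> carrier (group_ring G) \<and>
      single a \<otimes>\<^bsub>group_ring G\<^esub> single (inv a) = \<one>\<^bsub>group_ring G\<^esub> \<and>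
      single (inv a) \<otimes>\<^bsub>group_ring G\<^esub> single a = \<one>\<^bsub>group_ring G\<^esub>"
    using a by (simp add: group_ring_one single_in_group_ring)
next
  fix y assume y: "y \<in> carrier (group_ring G) \<and>
      single a \<otimes>\<^bsub>group_ring G\<^esub> y = \<one>\<^bsub>group_ring G\<^esub> \<and>
      y \<otimes>\<^bsub>group_ring G\<^esub> single a = \<one>\<^bsub>group_ring G\<^esub>"
  show "y = single (inv a)"
  proof
    fix b
    show "y b = single (inv a) b"
    proof (cases "b \<in> carrier G")
      case True
      then have "y b = single \<one> (a \<otimes> b)"
        using single_mult_apply [OF a True, of y] y by (simp add: group_ring_one)
      also have "\<dots> = single (inv a) b"
        using a True by (auto simp: single_def) (metis inv_equality inv_inv inv_comm)
      finally show ?thesis .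
    next
      case False
      then show ?thesis using y a by (auto simp: group_ring_def single_def)
    qed
  qed
qed

section \<open>Normal form of monomial matrices\<close>

definition mon ::
    "('k, 'n) monoid_scheme \<Rightarrow> 'i set \<Rightarrow> ('i \<Rightarrow> 'i) \<Rightarrow> ('i \<Rightarrow> 'k) \<Rightarrow> ('i \<times> 'i \<Rightarrow> 'k \<Rightarrow> int)" where
  "mon K I \<alpha> p =
     (\<lambda>(i, j) \<in> I \<times> I. if j = \<alpha> i then single (p i) else \<zero>\<^bsub>group_ring K\<^esub>)"

lemma mon_apply:
  "i \<in> I \<Longrightarrow> j \<in> I \<Longrightarrow>
    mon K I \<alpha> p (i, j) = (if j = \<alpha> i then single (p i) else \<zero>\<^bsub>group_ring K\<^esub>)"
  by (simp add: mon_def)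

lemma mon_cong:
  "\<lbrakk>\<And>i. i \<in> I \<Longrightarrow> \<alpha> i = \<beta> i; \<And>i. i \<in> I \<Longrightarrow> p i = r i\<rbrakk> \<Longrightarrow> mon K I \<alpha> p = mon K I \<beta> r"
  by (auto simp: mon_def restrict_def fun_eq_iff)

text \<open>The permutation is recovered everywhere, because \<open>permutes\<close> fixes it off
  \<open>I\<close>; the entries are recovered only on \<open>I\<close>, since their other values do
  not occur in the matrix.\<close>

lemma mon_eq_iff:
  assumes "\<alpha> permutes I" "\<beta> permutes I"
  shows "mon K I \<alpha> p = mon K I \<beta> r \<longleftrightarrow> \<alpha> = \<beta> \<and> (\<forall>i\<in>I. p i = r i)"
proof
  assume eq: "mon K I \<alpha> p = mon K I \<beta> r"
  have *: "\<alpha> i = \<beta> i \<and> p i = r i" if i: "i \<in> I" for i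
  proof -
    have "\<alpha> i \<in> I" using assms(1) i by (simp add: permutes_in_image)
    with i show ?thesis
      using fun_cong [OF eq, of "(i, \<alpha> i)"] by (auto simp: mon_apply split: if_splits)
  qed
  then show "\<alpha> = \<beta> \<and> (\<forall>i\<in>I. p i = r i)"
    using assms by (metis ext permutes_not_in)
qed (auto intro: mon_cong)

lemma mon_in_mats:
  assumes "p \<in> I \<rightarrow> carrier K"
  shows "mon K I \<alpha> p \<in> mats I (insert \<zero>\<^bsub>group_ring K\<^esub> (single ` carrier K))"
  using assms by (auto simp: mats_def mon_def split: if_splits)

lemma monomial_mon:
  assumes \<alpha>: "\<alpha> permutes I" and p: "p \<in> I \<rightarrow> carrier K"
  shows "monomial K I (mon K I \<alpha> p)"
  unfolding monomial_def
proof (intro conjI ballI)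
  fix i assume i: "i \<in> I"
  show "\<exists>!j. j \<in> I \<and> mon K I \<alpha> p (i, j) \<noteq> \<zero>\<^bsub>group_ring K\<^esub>"
    using i \<alpha> by (auto simp: mon_apply permutes_in_image intro!: ex1I [of _ "\<alpha> i"] split: if_splits)
next
  fix j assume j: "j \<in> I"
  show "\<exists>!i. i \<in> I \<and> mon K I \<alpha> p (i, j) \<noteq> \<zero>\<^bsub>group_ring K\<^esub>"
  proof (rule ex1I)
    show "inv_into UNIV \<alpha> j \<in> I \<and> mon K I \<alpha> p (inv_into UNIV \<alpha> j, j) \<noteq> \<zero>\<^bsub>group_ring K\<^esub>"
      using j \<alpha> permutes_in_image [OF permutes_inv [OF \<alpha>]]
      by (auto simp: mon_apply permutes_inverses)
  next
    fix i assume "i \<in> I \<and> mon K I \<alpha> p (i, j) \<noteq> \<zero>\<^bsub>group_ring K\<^esub>"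
    then show "i = inv_into UNIV \<alpha> j"
      using j \<alpha> by (auto simp: mon_apply permutes_inverses split: if_splits)
  qed
qed (use mon_in_mats [OF p] in auto)

text \<open>The single nonzero entry of each row defines \<alpha>. Uniqueness within columns makes
  \<alpha> injective, existence within columns makes it surjective.\<close>

lemma monomialE:
  fixes P :: "'i \<times> 'i \<Rightarrow> 'k \<Rightarrow> int"
  assumes P: "monomial K I P"
  obtains \<alpha> p where "\<alpha> permutes I" "p \<in> I \<rightarrow> carrier K" "P = mon K I \<alpha> p"
proof -
  let ?Z = "\<zero>\<^bsub>group_ring K\<^esub>"
  have mats: "P \<in> mats I (insert ?Z (single ` carrier K))"
    and row: "\<And>i. i \<in> I \<Longrightarrow> \<exists>!j. j \<in> I \<and> P (i, j) \<noteq> ?Z"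
    and col: "\<And>j. j \<in> I \<Longrightarrow> \<exists>!i. i \<in> I \<and> P (i, j) \<noteq> ?Z"
    using P by (auto simp: monomial_def)
  \<comment> \<open>The identity off \<open>I\<close> is the default that lets the map satisfy
    \<open>permutes\<close>.\<close>
  define \<alpha> where "\<alpha> i = (if i \<in> I then THE j. j \<in> I \<and> P (i, j) \<noteq> ?Z else i)" for i
  have \<alpha>: "\<alpha> i \<in> I \<and> P (i, \<alpha> i) \<noteq> ?Z" if "i \<in> I" for i
    using theI' [OF row [OF that]] that by (simp add: \<alpha>_def)
  have \<alpha>_unique: "j = \<alpha> i" if "i \<in> I" "j \<in> I" "P (i, j) \<noteq> ?Z" for i j
    using row [OF that(1)] \<alpha> [OF that(1)] that by blast
  have "bij_betw \<alpha> I I"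
  proof (rule bij_betw_imageI)
    show "inj_on \<alpha> I"
      by (rule inj_onI) (metis \<alpha> col)
    show "\<alpha> ` I = I"
    proof
      show "\<alpha> ` I \<subseteq> I" using \<alpha> by auto
      show "I \<subseteq> \<alpha> ` I"
      proof
        fix j assume "j \<in> I"
        with col obtain i where "i \<in> I" "P (i, j) \<noteq> ?Z" by blast
        with \<open>j \<in> I\<close> show "j \<in> \<alpha> ` I" using \<alpha>_unique by blast
      qed
    qed
  qed
  then have perm: "\<alpha> permutes I"
    by (rule bij_imp_permutes) (simp add: \<alpha>_def)
  have "\<exists>a. a \<in> carrier K \<and> P (i, \<alpha> i) = single a" if i: "i \<in> I" for i
  proof -
    have "P (i, \<alpha> i) \<in> insert ?Z (single ` carrier K)"
      using mats \<alpha> [OF i] i unfolding mats_def by blast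
    then show ?thesis using \<alpha> [OF i] by auto
  qed
  then obtain p where p: "\<And>i. i \<in> I \<Longrightarrow> p i \<in> carrier K \<and> P (i, \<alpha> i) = single (p i)"
    by metis
  have "P = mon K I \<alpha> p"
  proof
    fix x :: "'i \<times> 'i"
    obtain i j where x: "x = (i, j)" by force
    show "P x = mon K I \<alpha> p x"
    proof (cases "i \<in> I \<and> j \<in> I")
      case True
      then show ?thesis
        using p \<alpha>_unique by (auto simp: x mon_apply)
    next
      case False
      then have "x \<notin> I \<times> I" by (auto simp: x)
      \<comment> \<open>Off the index set both matrices take the value \<open>undefined\<close>,
        since matrices are extensional.\<close>
      then have "mon K I \<alpha> p x = undefined"
        unfolding mon_def by (rule restrict_apply [THEN trans, OF if_not_P])
      moreover have "P x = undefined"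
        by (rule PiE_arb [OF mats [unfolded mats_def] \<open>x \<notin> I \<times> I\<close>])
      ultimately show ?thesis by simp
    qed
  qed
  with perm p show ?thesis by (intro that [of \<alpha> p]) auto
qed

lemma perm_mat_iff:
  assumes "group K"
  shows "perm_mat K I P \<longleftrightarrow> (\<exists>\<alpha>. \<alpha> permutes I \<and> P = mon K I \<alpha> (\<lambda>_. \<one>\<^bsub>K\<^esub>))"
proof
  assume P: "perm_mat K I P"
  then obtain \<alpha> p where \<alpha>: "\<alpha> permutes I" and p: "p \<in> I \<rightarrow> carrier K" and eq: "P = mon K I \<alpha> p"
    by (auto simp: perm_mat_def elim: monomialE)
  have "p i = \<one>\<^bsub>K\<^esub>" if "i \<in> I" for i
  proof -
    have "\<alpha> i \<in> I" using \<alpha> that by (simp add: permutes_in_image)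
    then have "P (i, \<alpha> i) \<in> {\<zero>\<^bsub>group_ring K\<^esub>, \<one>\<^bsub>group_ring K\<^esub>}"
      using P that unfolding perm_mat_def mats_def by blast
    then show ?thesis using that \<open>\<alpha> i \<in> I\<close> by (simp add: eq mon_apply group_ring_one)
  qed
  then show "\<exists>\<alpha>. \<alpha> permutes I \<and> P = mon K I \<alpha> (\<lambda>_. \<one>\<^bsub>K\<^esub>)"
    using \<alpha> eq by (auto intro!: exI [of _ \<alpha>] mon_cong)
next
  interpret group K by fact
  assume "\<exists>\<alpha>. \<alpha> permutes I \<and> P = mon K I \<alpha> (\<lambda>_. \<one>\<^bsub>K\<^esub>)"
  then show "perm_mat K I P"
    by (auto simp: perm_mat_def mats_def mon_def group_ring_one split: if_splits
        intro!: monomial_mon [unfolded mon_def])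
qed

lemma scalar_mat_mon: "scalar_mat (group_ring K) I (single a) = mon K I id (\<lambda>_. a)"
  by (auto simp: scalar_mat_def mon_def restrict_def fun_eq_iff)

section \<open>Products with monomial factors\<close>

lemma mat_mult_mon_left:
  assumes K: "group K" and I: "finite I" and \<alpha>: "\<alpha> permutes I" and p: "p \<in> I \<rightarrow> carrier K"
    and A: "A \<in> mats I (insert \<zero>\<^bsub>group_ring K\<^esub> (single ` carrier K))"
  shows "mat_mult (group_ring K) I (mon K I \<alpha> p) A =
    (\<lambda>(i, j) \<in> I \<times> I. single (p i) \<otimes>\<^bsub>group_ring K\<^esub> A (\<alpha> i, j))"
  unfolding mat_mult_def
proof (rule restrict_ext, clarify)
  fix i j assume i: "i \<in> I" and j: "j \<in> I"
  let ?R = "group_ring K"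
  interpret R: abelian_monoid ?R by (rule abelian_monoid_group_ring)
  interpret group K by fact
  have \<alpha>i: "\<alpha> i \<in> I" using \<alpha> i by (simp add: permutes_in_image)
  \<comment> \<open>As the entries of \<open>A\<close> are zero or basis elements, closure follows
    from products of basis elements alone.\<close>
  have cl: "single (p i) \<otimes>\<^bsub>?R\<^esub> A (l, j) \<in> carrier ?R" if "l \<in> I" for l
  proof -
    have "A (l, j) \<in> insert \<zero>\<^bsub>?R\<^esub> (single ` carrier K)"
      using A that j unfolding mats_def by blast
    moreover have "p i \<in> carrier K" using p i by auto
    ultimately show ?thesis
      by (auto intro!: single_in_group_ring zero_in_group_ring)
  qed
  have "(\<Oplus>\<^bsub>?R\<^esub>l\<in>I. mon K I \<alpha> p (i, l) \<otimes>\<^bsub>?R\<^esub> A (l, j)) =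
      (\<Oplus>\<^bsub>?R\<^esub>l\<in>I. if \<alpha> i = l then single (p i) \<otimes>\<^bsub>?R\<^esub> A (l, j) else \<zero>\<^bsub>?R\<^esub>)"
    using i cl by (intro R.finsum_cong') (auto simp: mon_apply intro: zero_in_group_ring)
  also have "\<dots> = single (p i) \<otimes>\<^bsub>?R\<^esub> A (\<alpha> i, j)"
    using \<alpha>i I cl by (intro R.add.finprod_singleton) auto
  finally show "(\<Oplus>\<^bsub>?R\<^esub>l\<in>I. mon K I \<alpha> p (i, l) \<otimes>\<^bsub>?R\<^esub> A (l, j)) =
      single (p i) \<otimes>\<^bsub>?R\<^esub> A (\<alpha> i, j)" .
qed

text \<open>Row i of the first factor leads to column \<open>\<alpha> i\<close>, and row
  \<open>\<alpha> i\<close> of the second leads on to \<open>\<beta> (\<alpha> i)\<close>. Hence the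
  order of composition is opposite to the order of the product.\<close>

lemma mat_mult_mon:
  assumes "group K" "finite I" "\<alpha> permutes I" "p \<in> I \<rightarrow> carrier K" "r \<in> I \<rightarrow> carrier K"
  shows "mat_mult (group_ring K) I (mon K I \<alpha> p) (mon K I \<beta> r) =
    mon K I (\<beta> \<circ> \<alpha>) (\<lambda>i. p i \<otimes>\<^bsub>K\<^esub> r (\<alpha> i))"
proof -
  have "mat_mult (group_ring K) I (mon K I \<alpha> p) (mon K I \<beta> r) =
      (\<lambda>(i, j) \<in> I \<times> I. single (p i) \<otimes>\<^bsub>group_ring K\<^esub> mon K I \<beta> r (\<alpha> i, j))"
    using assms by (intro mat_mult_mon_left mon_in_mats)
  also have "\<dots> = mon K I (\<beta> \<circ> \<alpha>) (\<lambda>i. p i \<otimes>\<^bsub>K\<^esub> r (\<alpha> i))"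
    unfolding mon_def using assms(3) by (intro restrict_ext) (auto simp: permutes_in_image)
  finally show ?thesis .
qed

lemma star_transpose_mon:
  assumes "group K" "r \<in> I \<rightarrow> carrier K" "i \<in> I" "j \<in> I"
  shows "star_transpose K I (mon K I \<beta> r) (i, j) =
    (if i = \<beta> j then single (inv\<^bsub>K\<^esub> (r j)) else \<zero>\<^bsub>group_ring K\<^esub>)"
proof -
  have "r j \<in> carrier K" using assms(2,4) by auto
  with assms show ?thesis
    by (cases "i = \<beta> j") (auto simp: star_transpose_def mon_apply group.inv_single)
qed

text \<open>Column j of the starred transpose has its only nonzero entry in row
  \<open>\<beta> j\<close>, so each sum keeps one term.\<close>

lemma mat_mult_star_transpose_mon:
  assumes K: "group K" and I: "finite I" and \<beta>: "\<beta> permutes I" and r: "r \<in> I \<rightarrow> carrier K"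
    and A: "A \<in> mats I (single ` carrier K)"
  shows "mat_mult (group_ring K) I A (star_transpose K I (mon K I \<beta> r)) =
    (\<lambda>(i, j) \<in> I \<times> I. A (i, \<beta> j) \<otimes>\<^bsub>group_ring K\<^esub> single (inv\<^bsub>K\<^esub> (r j)))"
  unfolding mat_mult_def
proof (rule restrict_ext, clarify)
  fix i j assume i: "i \<in> I" and j: "j \<in> I"
  let ?R = "group_ring K"
  interpret R: abelian_monoid ?R by (rule abelian_monoid_group_ring)
  interpret group K by fact
  have \<beta>j: "\<beta> j \<in> I" using \<beta> j by (simp add: permutes_in_image)
  have cl: "A (i, l) \<otimes>\<^bsub>?R\<^esub> single (inv\<^bsub>K\<^esub> (r j)) \<in> carrier ?R" if "l \<in> I" for l
  proof -
    have "A (i, l) \<in> single ` carrier K"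
      using A that i unfolding mats_def by blast
    moreover have "r j \<in> carrier K" using r j by auto
    ultimately show ?thesis
      by (auto intro!: single_in_group_ring)
  qed
  have "(\<Oplus>\<^bsub>?R\<^esub>l\<in>I. A (i, l) \<otimes>\<^bsub>?R\<^esub> star_transpose K I (mon K I \<beta> r) (l, j)) =
      (\<Oplus>\<^bsub>?R\<^esub>l\<in>I. if \<beta> j = l then A (i, l) \<otimes>\<^bsub>?R\<^esub> single (inv\<^bsub>K\<^esub> (r j)) else \<zero>\<^bsub>?R\<^esub>)"
    using j r K cl
    by (intro R.finsum_cong') (auto simp: star_transpose_mon intro: zero_in_group_ring)
  also have "\<dots> = A (i, \<beta> j) \<otimes>\<^bsub>?R\<^esub> single (inv\<^bsub>K\<^esub> (r j))"
    using \<beta>j I cl by (intro R.add.finprod_singleton) auto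
  finally show "(\<Oplus>\<^bsub>?R\<^esub>l\<in>I. A (i, l) \<otimes>\<^bsub>?R\<^esub> star_transpose K I (mon K I \<beta> r) (l, j)) =
      A (i, \<beta> j) \<otimes>\<^bsub>?R\<^esub> single (inv\<^bsub>K\<^esub> (r j))" .
qed

lemma mon_mult_mult_star:
  assumes K: "group K" and I: "finite I" and \<alpha>: "\<alpha> permutes I" and p: "p \<in> I \<rightarrow> carrier K"
    and \<beta>: "\<beta> permutes I" and r: "r \<in> I \<rightarrow> carrier K" and M: "M \<in> mats I (carrier K)"
  shows "mat_mult (group_ring K) I
      (mat_mult (group_ring K) I (mon K I \<alpha> p) (map_mat I single M))
      (star_transpose K I (mon K I \<beta> r)) =
    (\<lambda>(i, j) \<in> I \<times> I. single (p i \<otimes>\<^bsub>K\<^esub> M (\<alpha> i, \<beta> j) \<otimes>\<^bsub>K\<^esub> inv\<^bsub>K\<^esub> (r j)))"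
proof -
  interpret group K by fact
  have M': "M (i, j) \<in> carrier K" if "i \<in> I" "j \<in> I" for i j
    using M that by (auto simp: mats_def)
  have pK: "p i \<in> carrier K" if "i \<in> I" for i using p that by auto
  have aI: "\<alpha> i \<in> I" "\<beta> i \<in> I" if "i \<in> I" for i using \<alpha> \<beta> that by (simp_all add: permutes_in_image)
  let ?PM = "\<lambda>(i, j) \<in> I \<times> I. single (p i \<otimes>\<^bsub>K\<^esub> M (\<alpha> i, j))"
  have "mat_mult (group_ring K) I (mon K I \<alpha> p) (map_mat I single M) =
      (\<lambda>(i, j) \<in> I \<times> I. single (p i) \<otimes>\<^bsub>group_ring K\<^esub> map_mat I single M (\<alpha> i, j))"
    using M' by (intro mat_mult_mon_left K I \<alpha> p) (auto simp: mats_def map_mat_def)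
  also have "\<dots> = ?PM"
    using aI by (intro restrict_ext) (auto simp: map_mat_def)
  finally have 1: "mat_mult (group_ring K) I (mon K I \<alpha> p) (map_mat I single M) = ?PM" .
  have "?PM \<in> mats I (single ` carrier K)"
    using pK aI M' by (auto simp: mats_def)
  then show ?thesis
    unfolding 1 using aI
    by (subst mat_mult_star_transpose_mon [OF K I \<beta> r]) (auto intro!: restrict_ext)
qed

text \<open>Distinct group elements give distinct basis elements, so the matrix equation can be
  compared entry by entry inside \<open>K\<close>; multiplying by \<open>r j\<close> clears the
  inverse. Membership in \<open>Aut\<close> is tested through this criterion from here on.\<close>

lemma mon_in_Aut_iff:
  fixes M :: "'i \<times> 'i \<Rightarrow> 'k"
  assumes K: "group K" and I: "finite I" and \<alpha>: "\<alpha> permutes I" and p: "p \<in> I \<rightarrow> carrier K"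
    and \<beta>: "\<beta> permutes I" and r: "r \<in> I \<rightarrow> carrier K" and M: "M \<in> mats I (carrier K)"
  shows "(mon K I \<alpha> p, mon K I \<beta> r) \<in> carrier (Aut K I M) \<longleftrightarrow>
    (\<forall>i\<in>I. \<forall>j\<in>I. p i \<otimes>\<^bsub>K\<^esub> M (\<alpha> i, \<beta> j) = M (i, j) \<otimes>\<^bsub>K\<^esub> r j)"
proof -
  interpret group K by fact
  have "(mon K I \<alpha> p, mon K I \<beta> r) \<in> carrier (Aut K I M) \<longleftrightarrow>
      (\<lambda>(i, j) \<in> I \<times> I. single (p i \<otimes>\<^bsub>K\<^esub> M (\<alpha> i, \<beta> j) \<otimes>\<^bsub>K\<^esub> inv\<^bsub>K\<^esub> (r j))) = map_mat I single M"
    using assms by (simp add: Aut_def monomial_mon mon_mult_mult_star)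
  also have "\<dots> \<longleftrightarrow> (\<forall>i\<in>I. \<forall>j\<in>I. p i \<otimes>\<^bsub>K\<^esub> M (\<alpha> i, \<beta> j) \<otimes>\<^bsub>K\<^esub> inv\<^bsub>K\<^esub> (r j) = M (i, j))"
    by (auto simp: map_mat_def restrict_def fun_eq_iff [where 'a = "'i \<times> 'i"])
  also have "\<dots> \<longleftrightarrow> (\<forall>i\<in>I. \<forall>j\<in>I. p i \<otimes>\<^bsub>K\<^esub> M (\<alpha> i, \<beta> j) = M (i, j) \<otimes>\<^bsub>K\<^esub> r j)"
  proof (intro ball_cong refl)
    fix i j assume "i \<in> I" "j \<in> I"
    then have "p i \<in> carrier K" "r j \<in> carrier K" "M (i, j) \<in> carrier K" "M (\<alpha> i, \<beta> j) \<in> carrier K"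
      using assms by (auto simp: mats_def permutes_in_image)
    then show "p i \<otimes>\<^bsub>K\<^esub> M (\<alpha> i, \<beta> j) \<otimes>\<^bsub>K\<^esub> inv\<^bsub>K\<^esub> (r j) = M (i, j) \<longleftrightarrow>
        p i \<otimes>\<^bsub>K\<^esub> M (\<alpha> i, \<beta> j) = M (i, j) \<otimes>\<^bsub>K\<^esub> r j"
      using inv_solve_right' by (metis m_closed)
  qed
  finally show ?thesis .
qed

lemma AutE:
  assumes "g \<in> carrier (Aut K I M)"
  obtains \<alpha> p \<beta> r where "\<alpha> permutes I" "p \<in> I \<rightarrow> carrier K" "\<beta> permutes I" "r \<in> I \<rightarrow> carrier K"
    "g = (mon K I \<alpha> p, mon K I \<beta> r)"
proof -
  obtain P Q where "g = (P, Q)" "monomial K I P" "monomial K I Q"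
    using assms by (auto simp: Aut_def)
  then show ?thesis by (elim monomialE) (rule that, simp_all)
qed

lemma Aut_mult:
  "(P, Q) \<otimes>\<^bsub>Aut K I M\<^esub> (R, S) =
    (mat_mult (group_ring K) I P R, mat_mult (group_ring K) I Q S)"
  by (simp add: Aut_def)

lemma Aut_one: "\<one>\<^bsub>Aut K I M\<^esub> = (mon K I id (\<lambda>_. \<one>\<^bsub>K\<^esub>), mon K I id (\<lambda>_. \<one>\<^bsub>K\<^esub>))"
  by (simp add: Aut_def group_ring_one scalar_mat_mon)

section \<open>Automorphism groups and their actions\<close>

lemma mon_mult_closed:
  assumes "group K" "\<alpha> permutes I" "p \<in> I \<rightarrow> carrier K" "r \<in> I \<rightarrow> carrier K"
  shows "(\<lambda>i. p i \<otimes>\<^bsub>K\<^esub> r (\<alpha> i)) \<in> I \<rightarrow> carrier K"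
proof -
  interpret group K by fact
  show ?thesis using assms by (auto simp: Pi_def permutes_in_image)
qed

lemma Aut_mult_mon:
  assumes "group K" "finite I" "\<alpha> permutes I" "\<beta> permutes I"
    "p \<in> I \<rightarrow> carrier K" "r \<in> I \<rightarrow> carrier K" "p' \<in> I \<rightarrow> carrier K" "r' \<in> I \<rightarrow> carrier K"
  shows "(mon K I \<alpha> p, mon K I \<beta> r) \<otimes>\<^bsub>Aut K I M\<^esub> (mon K I \<alpha>' p', mon K I \<beta>' r') =
    (mon K I (\<alpha>' \<circ> \<alpha>) (\<lambda>i. p i \<otimes>\<^bsub>K\<^esub> p' (\<alpha> i)), mon K I (\<beta>' \<circ> \<beta>) (\<lambda>j. r j \<otimes>\<^bsub>K\<^esub> r' (\<beta> j)))"
  using assms by (simp add: Aut_mult mat_mult_mon)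

text \<open>The equation of the second pair is used at the position
  \<open>(\<alpha> i, \<beta> j)\<close> to which the first pair leads from (i, j); the equation of
  the first pair then applies at (i, j).\<close>

lemma Aut_mon_closed:
  assumes K: "group K" and I: "finite I" and M: "M \<in> mats I (carrier K)"
    and perm: "\<alpha> permutes I" "\<beta> permutes I" "\<alpha>' permutes I" "\<beta>' permutes I"
    and fn: "p \<in> I \<rightarrow> carrier K" "r \<in> I \<rightarrow> carrier K" "p' \<in> I \<rightarrow> carrier K" "r' \<in> I \<rightarrow> carrier K"
    and g: "(mon K I \<alpha> p, mon K I \<beta> r) \<in> carrier (Aut K I M)"
    and h: "(mon K I \<alpha>' p', mon K I \<beta>' r') \<in> carrier (Aut K I M)"
  shows "(mon K I (\<alpha>' \<circ> \<alpha>) (\<lambda>i. p i \<otimes>\<^bsub>K\<^esub> p' (\<alpha> i)), mon K I (\<beta>' \<circ> \<beta>) (\<lambda>j. r j \<otimes>\<^bsub>K\<^esub> r' (\<beta> j)))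
    \<in> carrier (Aut K I M)"
proof -
  interpret group K by fact
  have g': "p i \<otimes>\<^bsub>K\<^esub> M (\<alpha> i, \<beta> j) = M (i, j) \<otimes>\<^bsub>K\<^esub> r j" if "i \<in> I" "j \<in> I" for i j
    using g that by (simp add: mon_in_Aut_iff [OF K I perm(1) fn(1) perm(2) fn(2) M])
  have h': "p' i \<otimes>\<^bsub>K\<^esub> M (\<alpha>' i, \<beta>' j) = M (i, j) \<otimes>\<^bsub>K\<^esub> r' j" if "i \<in> I" "j \<in> I" for i j
    using h that by (simp add: mon_in_Aut_iff [OF K I perm(3) fn(3) perm(4) fn(4) M])
  have "(p i \<otimes>\<^bsub>K\<^esub> p' (\<alpha> i)) \<otimes>\<^bsub>K\<^esub> M (\<alpha>' (\<alpha> i), \<beta>' (\<beta> j)) = M (i, j) \<otimes>\<^bsub>K\<^esub> (r j \<otimes>\<^bsub>K\<^esub> r' (\<beta> j))"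
    if i: "i \<in> I" and j: "j \<in> I" for i j
  proof -
    have I': "\<alpha> i \<in> I" "\<beta> j \<in> I" "\<alpha>' (\<alpha> i) \<in> I" "\<beta>' (\<beta> j) \<in> I"
      using i j perm by (simp_all add: permutes_in_image)
    have cl: "p i \<in> carrier K" "p' (\<alpha> i) \<in> carrier K" "r j \<in> carrier K" "r' (\<beta> j) \<in> carrier K"
      "M (\<alpha>' (\<alpha> i), \<beta>' (\<beta> j)) \<in> carrier K" "M (i, j) \<in> carrier K" "M (\<alpha> i, \<beta> j) \<in> carrier K"
      using i j I' fn M by (auto simp: mats_def)
    have "(p i \<otimes>\<^bsub>K\<^esub> p' (\<alpha> i)) \<otimes>\<^bsub>K\<^esub> M (\<alpha>' (\<alpha> i), \<beta>' (\<beta> j)) =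
        p i \<otimes>\<^bsub>K\<^esub> (M (\<alpha> i, \<beta> j) \<otimes>\<^bsub>K\<^esub> r' (\<beta> j))"
      using h' [OF I'(1,2)] cl by (simp add: m_assoc)
    also have "\<dots> = M (i, j) \<otimes>\<^bsub>K\<^esub> (r j \<otimes>\<^bsub>K\<^esub> r' (\<beta> j))"
      using g' [OF i j] cl by (simp flip: m_assoc)
    finally show ?thesis .
  qed
  then show ?thesis
    by (subst mon_in_Aut_iff [OF K I permutes_compose [OF perm(1,3)] mon_mult_closed [OF K perm(1) fn(1,3)]
          permutes_compose [OF perm(2,4)] mon_mult_closed [OF K perm(2) fn(2,4)] M]) simp
qed

lemma Aut_one_closed:
  assumes "group K" "finite I" "M \<in> mats I (carrier K)"
  shows "\<one>\<^bsub>Aut K I M\<^esub> \<in> carrier (Aut K I M)"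
proof -
  interpret group K by fact
  have "M (i, j) \<in> carrier K" if "i \<in> I" "j \<in> I" for i j
    using assms(3) that by (auto simp: mats_def)
  then show ?thesis
    unfolding Aut_one using assms by (subst mon_in_Aut_iff) auto
qed

text \<open>The equation of the given pair, read at the preimages of i and j, is solved for the
  entry of \<open>M\<close> at these preimages.\<close>

lemma Aut_mon_inv_closed:
  assumes K: "group K" and I: "finite I" and M: "M \<in> mats I (carrier K)"
    and \<alpha>: "\<alpha> permutes I" and \<beta>: "\<beta> permutes I" and p: "p \<in> I \<rightarrow> carrier K" and r: "r \<in> I \<rightarrow> carrier K"
    and g: "(mon K I \<alpha> p, mon K I \<beta> r) \<in> carrier (Aut K I M)"
  shows "(mon K I (inv_into UNIV \<alpha>) (\<lambda>i. inv\<^bsub>K\<^esub> (p (inv_into UNIV \<alpha> i))),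
      mon K I (inv_into UNIV \<beta>) (\<lambda>j. inv\<^bsub>K\<^esub> (r (inv_into UNIV \<beta> j)))) \<in> carrier (Aut K I M)"
proof -
  interpret group K by fact
  define \<alpha>' where "\<alpha>' = inv_into UNIV \<alpha>"
  define \<beta>' where "\<beta>' = inv_into UNIV \<beta>"
  have \<alpha>': "\<alpha>' permutes I" and \<beta>': "\<beta>' permutes I"
    using \<alpha> \<beta> by (simp_all add: \<alpha>'_def \<beta>'_def permutes_inv)
  have p': "(\<lambda>i. inv\<^bsub>K\<^esub> (p (\<alpha>' i))) \<in> I \<rightarrow> carrier K" and r': "(\<lambda>j. inv\<^bsub>K\<^esub> (r (\<beta>' j))) \<in> I \<rightarrow> carrier K"
    using p r \<alpha>' \<beta>' by (auto simp: Pi_def permutes_in_image)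
  have "inv\<^bsub>K\<^esub> (p (\<alpha>' i)) \<otimes>\<^bsub>K\<^esub> M (\<alpha>' i, \<beta>' j) = M (i, j) \<otimes>\<^bsub>K\<^esub> inv\<^bsub>K\<^esub> (r (\<beta>' j))"
    if i: "i \<in> I" and j: "j \<in> I" for i j
  proof -
    have I': "\<alpha>' i \<in> I" "\<beta>' j \<in> I"
      using i j \<alpha>' \<beta>' by (simp_all add: permutes_in_image)
    have cl: "p (\<alpha>' i) \<in> carrier K" "r (\<beta>' j) \<in> carrier K" "M (\<alpha>' i, \<beta>' j) \<in> carrier K"
      "M (i, j) \<in> carrier K"
      using i j I' p r M by (auto simp: mats_def)
    have "p (\<alpha>' i) \<otimes>\<^bsub>K\<^esub> M (\<alpha> (\<alpha>' i), \<beta> (\<beta>' j)) = M (\<alpha>' i, \<beta>' j) \<otimes>\<^bsub>K\<^esub> r (\<beta>' j)"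
      using g I' by (simp add: mon_in_Aut_iff [OF K I \<alpha> p \<beta> r M])
    moreover have "\<alpha> (\<alpha>' i) = i" "\<beta> (\<beta>' j) = j"
      using \<alpha> \<beta> by (simp_all add: \<alpha>'_def \<beta>'_def permutes_inverses)
    ultimately have "M (\<alpha>' i, \<beta>' j) = p (\<alpha>' i) \<otimes>\<^bsub>K\<^esub> M (i, j) \<otimes>\<^bsub>K\<^esub> inv\<^bsub>K\<^esub> (r (\<beta>' j))"
      using cl inv_solve_right by (metis m_closed)
    then show ?thesis using cl by (simp flip: m_assoc)
  qed
  then show ?thesis
    unfolding \<alpha>'_def [symmetric] \<beta>'_def [symmetric]
    by (subst mon_in_Aut_iff [OF K I \<alpha>' p' \<beta>' r' M]) auto
qed

lemma group_Aut:
  assumes K: "group K" and I: "finite I" and M: "M \<in> mats I (carrier K)"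
  shows "group (Aut K I M)"
proof (rule groupI)
  interpret group K by fact
  fix g assume g: "g \<in> carrier (Aut K I M)"
  then obtain \<alpha> p \<beta> r where g_eq: "g = (mon K I \<alpha> p, mon K I \<beta> r)"
    and \<alpha>: "\<alpha> permutes I" and \<beta>: "\<beta> permutes I" and p: "p \<in> I \<rightarrow> carrier K" and r: "r \<in> I \<rightarrow> carrier K"
    by (rule AutE)
  show "\<one>\<^bsub>Aut K I M\<^esub> \<otimes>\<^bsub>Aut K I M\<^esub> g = g"
    using K I \<alpha> \<beta> p r by (auto simp: g_eq Aut_one Aut_mult_mon Pi_def intro!: mon_cong)
  show "\<exists>h\<in>carrier (Aut K I M). h \<otimes>\<^bsub>Aut K I M\<^esub> g = \<one>\<^bsub>Aut K I M\<^esub>"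
  proof (rule bexI [OF _ Aut_mon_inv_closed [OF K I M \<alpha> \<beta> p r g [unfolded g_eq]]])
    have "inv_into UNIV \<alpha> i \<in> I" "inv_into UNIV \<beta> i \<in> I" if "i \<in> I" for i
      using permutes_in_image [OF permutes_inv [OF \<alpha>]] permutes_in_image [OF permutes_inv [OF \<beta>]] that
      by auto
    then show "(mon K I (inv_into UNIV \<alpha>) (\<lambda>i. inv\<^bsub>K\<^esub> (p (inv_into UNIV \<alpha> i))),
        mon K I (inv_into UNIV \<beta>) (\<lambda>j. inv\<^bsub>K\<^esub> (r (inv_into UNIV \<beta> j)))) \<otimes>\<^bsub>Aut K I M\<^esub> g
        = \<one>\<^bsub>Aut K I M\<^esub>"
      using K I \<alpha> \<beta> p r
      by (auto simp: g_eq Aut_one Aut_mult_mon permutes_inv Pi_def permutes_inverses intro!: mon_cong)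
  qed
  fix h assume h: "h \<in> carrier (Aut K I M)"
  then obtain \<alpha>' p' \<beta>' r' where h_eq: "h = (mon K I \<alpha>' p', mon K I \<beta>' r')"
    and \<alpha>': "\<alpha>' permutes I" and \<beta>': "\<beta>' permutes I"
    and p': "p' \<in> I \<rightarrow> carrier K" and r': "r' \<in> I \<rightarrow> carrier K"
    by (rule AutE)
  show "g \<otimes>\<^bsub>Aut K I M\<^esub> h \<in> carrier (Aut K I M)"
    using Aut_mon_closed [OF K I M \<alpha> \<beta> \<alpha>' \<beta>' p r p' r'] g h K I \<alpha> \<beta> p r p' r'
    by (simp add: g_eq h_eq Aut_mult_mon)
  fix k assume k: "k \<in> carrier (Aut K I M)"
  then obtain \<alpha>'' p'' \<beta>'' r'' where k_eq: "k = (mon K I \<alpha>'' p'', mon K I \<beta>'' r'')"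
    and \<alpha>'': "\<alpha>'' permutes I" and \<beta>'': "\<beta>'' permutes I"
    and p'': "p'' \<in> I \<rightarrow> carrier K" and r'': "r'' \<in> I \<rightarrow> carrier K"
    by (rule AutE)
  have 1: "(\<lambda>i. p i \<otimes>\<^bsub>K\<^esub> p' (\<alpha> i)) \<in> I \<rightarrow> carrier K" "(\<lambda>j. r j \<otimes>\<^bsub>K\<^esub> r' (\<beta> j)) \<in> I \<rightarrow> carrier K"
    "(\<lambda>i. p' i \<otimes>\<^bsub>K\<^esub> p'' (\<alpha>' i)) \<in> I \<rightarrow> carrier K" "(\<lambda>j. r' j \<otimes>\<^bsub>K\<^esub> r'' (\<beta>' j)) \<in> I \<rightarrow> carrier K"
    using K \<alpha> \<beta> \<alpha>' \<beta>' p r p' r' p'' r'' by (simp_all only: mon_mult_closed)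
  have 2: "\<alpha> i \<in> I" "\<beta> i \<in> I" "\<alpha>' i \<in> I" "\<beta>' i \<in> I" if "i \<in> I" for i
    using \<alpha> \<beta> \<alpha>' \<beta>' that by (simp_all add: permutes_in_image)
  show "g \<otimes>\<^bsub>Aut K I M\<^esub> h \<otimes>\<^bsub>Aut K I M\<^esub> k = g \<otimes>\<^bsub>Aut K I M\<^esub> (h \<otimes>\<^bsub>Aut K I M\<^esub> k)"
    unfolding g_eq h_eq k_eq
    by (simp only: Aut_mult_mon [OF K I \<alpha> \<beta> p r] Aut_mult_mon [OF K I \<alpha>' \<beta>' p' r'] 1 p' r' p'' r''
        Aut_mult_mon [OF K I permutes_compose [OF \<alpha> \<alpha>'] permutes_compose [OF \<beta> \<beta>'] 1(1,2) p'' r''] o_assoc)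
      (use 2 p r p' r' p'' r'' in \<open>auto intro!: mon_cong m_assoc\<close>)
qed (use assms in \<open>rule Aut_one_closed\<close>)

section \<open>Permutation automorphisms\<close>

lemma PAut_carrier:
  assumes "group K"
  shows "carrier (PAut K I M) = {(mon K I \<alpha> (\<lambda>_. \<one>\<^bsub>K\<^esub>), mon K I \<beta> (\<lambda>_. \<one>\<^bsub>K\<^esub>)) |\<alpha> \<beta>.
    \<alpha> permutes I \<and> \<beta> permutes I \<and>
    (mon K I \<alpha> (\<lambda>_. \<one>\<^bsub>K\<^esub>), mon K I \<beta> (\<lambda>_. \<one>\<^bsub>K\<^esub>)) \<in> carrier (Aut K I M)}"
  by (auto simp: PAut_def perm_mat_iff [OF assms])

text \<open>\<open>PAut\<close> differs from \<open>Aut\<close> in the carrier only, so the group on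
  \<open>S\<close> in \<open>regular_subgroup\<close> is a restriction of \<open>Aut\<close> and
  inherits its actions.\<close>

lemma PAut_restrict: "PAut K I M\<lparr>carrier := S\<rparr> = Aut K I M\<lparr>carrier := S\<rparr>"
  by (simp add: PAut_def)

lemma subgroup_PAut_Aut:
  assumes K: "group K" and I: "finite I" and M: "M \<in> mats I (carrier K)"
  shows "subgroup (carrier (PAut K I M)) (Aut K I M)"
proof -
  interpret K: group K by fact
  interpret A: group "Aut K I M" using assms by (rule group_Aut)
  have one: "(\<lambda>_. \<one>\<^bsub>K\<^esub>) \<in> I \<rightarrow> carrier K" by simp
  show ?thesis
  proof (rule A.subgroupI)
    show sub: "carrier (PAut K I M) \<subseteq> carrier (Aut K I M)"
      by (auto simp: PAut_def)
    have "\<one>\<^bsub>Aut K I M\<^esub> \<in> carrier (PAut K I M)"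
      using A.one_closed by (auto simp: PAut_carrier [OF K] Aut_one intro!: exI [of _ id])
    then show "carrier (PAut K I M) \<noteq> {}" by blast
    fix g assume g: "g \<in> carrier (PAut K I M)"
    then obtain \<alpha> \<beta> where \<alpha>: "\<alpha> permutes I" and \<beta>: "\<beta> permutes I"
      and g_eq: "g = (mon K I \<alpha> (\<lambda>_. \<one>\<^bsub>K\<^esub>), mon K I \<beta> (\<lambda>_. \<one>\<^bsub>K\<^esub>))"
      by (auto simp: PAut_carrier [OF K])
    have gA: "g \<in> carrier (Aut K I M)" using g sub by blast
    let ?h = "(mon K I (inv_into UNIV \<alpha>) (\<lambda>_. \<one>\<^bsub>K\<^esub>), mon K I (inv_into UNIV \<beta>) (\<lambda>_. \<one>\<^bsub>K\<^esub>))"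
    have hA: "?h \<in> carrier (Aut K I M)"
      using Aut_mon_inv_closed [OF K I M \<alpha> \<beta> one one gA [unfolded g_eq]] by simp
    have "?h \<otimes>\<^bsub>Aut K I M\<^esub> g = \<one>\<^bsub>Aut K I M\<^esub>"
      using K I \<alpha> \<beta> by (simp add: g_eq Aut_mult_mon permutes_inv Aut_one permutes_inv_o)
    then have "inv\<^bsub>Aut K I M\<^esub> g = ?h"
      using gA hA by (rule A.inv_equality)
    then show "inv\<^bsub>Aut K I M\<^esub> g \<in> carrier (PAut K I M)"
      using hA \<alpha> \<beta> by (auto simp: PAut_carrier [OF K] intro: permutes_inv)
    fix h assume h: "h \<in> carrier (PAut K I M)"
    then obtain \<alpha>' \<beta>' where \<alpha>': "\<alpha>' permutes I" and \<beta>': "\<beta>' permutes I"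
      and h_eq: "h = (mon K I \<alpha>' (\<lambda>_. \<one>\<^bsub>K\<^esub>), mon K I \<beta>' (\<lambda>_. \<one>\<^bsub>K\<^esub>))"
      by (auto simp: PAut_carrier [OF K])
    have "g \<otimes>\<^bsub>Aut K I M\<^esub> h \<in> carrier (Aut K I M)" using sub g h by blast
    moreover have "g \<otimes>\<^bsub>Aut K I M\<^esub> h =
        (mon K I (\<alpha>' \<circ> \<alpha>) (\<lambda>_. \<one>\<^bsub>K\<^esub>), mon K I (\<beta>' \<circ> \<beta>) (\<lambda>_. \<one>\<^bsub>K\<^esub>))"
      using K I \<alpha> \<beta> by (simp add: g_eq h_eq Aut_mult_mon)
    ultimately show "g \<otimes>\<^bsub>Aut K I M\<^esub> h \<in> carrier (PAut K I M)"
      using \<alpha> \<beta> \<alpha>' \<beta>' by (auto simp: PAut_carrier [OF K] intro: permutes_compose)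
  qed
qed

lemma group_PAut:
  assumes "group K" "finite I" "M \<in> mats I (carrier K)"
  shows "group (PAut K I M)"
proof -
  have "PAut K I M = Aut K I M\<lparr>carrier := carrier (PAut K I M)\<rparr>"
    by (simp add: PAut_def)
  then show ?thesis
    using group.subgroup_imp_group [OF group_Aut subgroup_PAut_Aut] assms by metis
qed

section \<open>Induced actions on rows and columns\<close>

lemma perm_of_mon:
  assumes \<alpha>: "\<alpha> permutes I"
  shows "perm_of K I (mon K I \<alpha> p) = restrict (inv_into UNIV \<alpha>) I"
  unfolding perm_of_def
proof (rule restrict_ext)
  fix i assume i: "i \<in> I"
  show "(THE i'. i' \<in> I \<and> mon K I \<alpha> p (i', i) \<noteq> \<zero>\<^bsub>group_ring K\<^esub>) = inv_into UNIV \<alpha> i"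
  proof (rule the_equality)
    show "inv_into UNIV \<alpha> i \<in> I \<and> mon K I \<alpha> p (inv_into UNIV \<alpha> i, i) \<noteq> \<zero>\<^bsub>group_ring K\<^esub>"
      using i \<alpha> permutes_in_image [OF permutes_inv [OF \<alpha>]] by (auto simp: mon_apply permutes_inverses)
  qed (use i \<alpha> in \<open>auto simp: mon_apply permutes_inverses split: if_splits\<close>)
qed

lemma perm_of_mon_eq_iff:
  assumes "\<alpha> permutes I" "i \<in> I"
  shows "perm_of K I (mon K I \<alpha> p) i = j \<longleftrightarrow> \<alpha> j = i"
  using assms by (auto simp: perm_of_mon permutes_inverses)

lemma restrict_permutes_in_Bij:
  assumes "\<alpha> permutes I"
  shows "restrict \<alpha> I \<in> Bij I"
  using permutes_imp_bij [OF assms] by (simp add: Bij_def)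

text \<open>Products reverse the composition of the permutations and \<open>perm_of\<close> inverts
  them; the two reversals cancel. Restriction to \<open>I\<close> is needed because elements of
  \<open>BijGroup I\<close> are extensional.\<close>

lemma group_action_Aut:
  assumes K: "group K" and I: "finite I" and M: "M \<in> mats I (carrier K)"
  shows "group_action (Aut K I M) I (\<lambda>(P, Q). perm_of K I P)"
    and "group_action (Aut K I M) I (\<lambda>(P, Q). perm_of K I Q)"
proof -
  have comp: "restrict (inv_into UNIV (\<beta> \<circ> \<alpha>)) I =
      restrict (inv_into UNIV \<alpha>) I \<otimes>\<^bsub>BijGroup I\<^esub> restrict (inv_into UNIV \<beta>) I"
    if \<alpha>: "\<alpha> permutes I" and \<beta>: "\<beta> permutes I" for \<alpha> \<beta>
    using restrict_permutes_in_Bij [OF permutes_inv [OF \<alpha>]] restrict_permutes_in_Bij [OF permutes_inv [OF \<beta>]]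
      permutes_in_image [OF permutes_inv [OF \<beta>]] o_inv_distrib [OF permutes_bij [OF \<beta>] permutes_bij [OF \<alpha>]]
    by (auto simp: BijGroup_def compose_def intro!: restrict_ext)
  have hom: "(\<lambda>(P, Q). perm_of K I P) \<in> hom (Aut K I M) (BijGroup I) \<and>
      (\<lambda>(P, Q). perm_of K I Q) \<in> hom (Aut K I M) (BijGroup I)"
    by (auto intro!: homI elim!: AutE
        simp: Aut_mult_mon [OF K I] perm_of_mon permutes_compose comp)
      (auto simp: BijGroup_def intro: restrict_permutes_in_Bij permutes_inv)
  then show "group_action (Aut K I M) I (\<lambda>(P, Q). perm_of K I P)"
    and "group_action (Aut K I M) I (\<lambda>(P, Q). perm_of K I Q)"
    using group_Aut [OF assms] group_BijGroup
    by (simp_all add: group_action_def group_hom_def group_hom_axioms_def)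
qed

lemma group_action_subgroup:
  assumes "group_action G E \<rho>" "subgroup S G"
  shows "group_action (G\<lparr>carrier := S\<rparr>) E \<rho>"
proof -
  interpret group_action G E \<rho> by fact
  interpret group_hom G "BijGroup E" \<rho> by (rule group_hom)
  interpret subgroup S G by fact
  have "\<rho> \<in> hom (G\<lparr>carrier := S\<rparr>) (BijGroup E)"
    using homh subset by (auto simp: hom_def)
  then show ?thesis
    using G.subgroup_imp_group [OF assms(2)] group_BijGroup
    by (simp add: group_action_def group_hom_def group_hom_axioms_def)
qed

section \<open>Free and regular actions\<close>

lemma (in group_action) inj_on_if_stabilizer_trivial:
  assumes stab: "stabilizer G \<phi> x = {\<one>}" and x: "x \<in> E"
  shows "inj_on (\<lambda>g. \<phi> g x) (carrier G)"
proof (rule inj_onI)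
  interpret group_hom G "BijGroup E" \<phi> by (rule group_hom)
  fix g h assume g: "g \<in> carrier G" and h: "h \<in> carrier G" and eq: "\<phi> g x = \<phi> h x"
  have "\<phi> (inv h \<otimes> g) x = \<phi> (inv h) (\<phi> g x)"
    using x g h by (intro composition_rule) auto
  also have "\<dots> = x"
    using orbit_sym_aux [OF h x] eq by simp
  finally have "inv h \<otimes> g \<in> stabilizer G \<phi> x"
    using g h by (simp add: stabilizer_def)
  then have "inv h \<otimes> g = \<one>"
    using stab by simp
  then show "g = h"
    using g h by (metis G.inv_equality G.inv_inv G.inv_closed)
qed

text \<open>This is how freeness is exploited later: two automorphisms are identified from the image
  of a single row or a single column.\<close>

lemma regular_actionD:
  assumes "regular_action G E \<rho>" "g \<in> carrier G" "h \<in> carrier G" "x \<in> E" "\<rho> g x = \<rho> h x"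
  shows "g = h"
proof -
  interpret transitive_action G E \<rho>
    using assms(1) by (simp add: regular_action_def)
  show ?thesis
    using inj_on_if_stabilizer_trivial assms by (auto simp: regular_action_def dest: inj_onD)
qed

text \<open>A free action embeds the group into \<open>E\<close> through any orbit map; an injection
  between finite sets of equal size is onto, which is transitivity.\<close>

lemma regular_actionI_card:
  assumes act: "group_action G E \<rho>" and E: "finite E" and card: "card (carrier G) = card E"
    and semireg: "\<And>g x. \<lbrakk>g \<in> carrier G; x \<in> E; \<rho> g x = x\<rbrakk> \<Longrightarrow> g = \<one>\<^bsub>G\<^esub>"
  shows "regular_action G E \<rho>"
proof -
  interpret group_action G E \<rho> by fact
  have stab: "stabilizer G \<rho> x = {\<one>\<^bsub>G\<^esub>}" if "x \<in> E" for x
    using semireg that stabilizer_one_closed [OF that] by (auto simp: stabilizer_def)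
  have "\<exists>g\<in>carrier G. \<rho> g x = y" if x: "x \<in> E" and y: "y \<in> E" for x y
  proof -
    have "(\<lambda>g. \<rho> g x) ` carrier G \<subseteq> E"
      using element_image x by auto
    then have "(\<lambda>g. \<rho> g x) ` carrier G = E"
      using E card_image [OF inj_on_if_stabilizer_trivial [OF stab [OF x] x]] card
      by (metis card_subset_eq)
    then show ?thesis using y by force
  qed
  then have "transitive_action G E \<rho>"
    using act by (simp add: transitive_action_def transitive_action_axioms_def)
  with stab show ?thesis by (simp add: regular_action_def)
qed

lemma PAut_one: "\<one>\<^bsub>PAut K I M\<^esub> = \<one>\<^bsub>Aut K I M\<^esub>"
  by (simp add: PAut_def)

text \<open>Rows and columns share the index set \<open>E\<close>, so one count serves both
  actions.\<close>

lemma regular_subgroupI_card: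
  assumes K: "group K" and E: "finite E" and M: "M \<in> mats E (carrier K)"
    and S: "subgroup S (PAut K E M)" and card: "card S = card E"
    and rows: "\<And>g x. \<lbrakk>g \<in> S; x \<in> E; perm_of K E (fst g) x = x\<rbrakk> \<Longrightarrow> g = \<one>\<^bsub>PAut K E M\<^esub>"
    and cols: "\<And>g x. \<lbrakk>g \<in> S; x \<in> E; perm_of K E (snd g) x = x\<rbrakk> \<Longrightarrow> g = \<one>\<^bsub>PAut K E M\<^esub>"
  shows "regular_subgroup K E M S"
proof -
  interpret A: group "Aut K E M" using K E M by (rule group_Aut)
  have "PAut K E M = Aut K E M\<lparr>carrier := carrier (PAut K E M)\<rparr>"
    by (simp add: PAut_def)
  then have S': "subgroup S (Aut K E M)"
    using A.incl_subgroup [OF subgroup_PAut_Aut [OF K E M]] S by metis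
  show ?thesis
    unfolding regular_subgroup_def
  proof (intro conjI)
    show "regular_action (PAut K E M\<lparr>carrier := S\<rparr>) E (\<lambda>(P, Q). perm_of K E P)"
      using group_action_subgroup [OF group_action_Aut(1) [OF K E M] S'] E card rows
      by (intro regular_actionI_card) (auto simp: PAut_restrict case_prod_beta PAut_one)
    show "regular_action (PAut K E M\<lparr>carrier := S\<rparr>) E (\<lambda>(P, Q). perm_of K E Q)"
      using group_action_subgroup [OF group_action_Aut(2) [OF K E M] S'] E card cols
      by (intro regular_actionI_card) (auto simp: PAut_restrict case_prod_beta PAut_one)
  qed fact
qed

section \<open>The expanded matrix\<close>

text \<open>The imprimitive action of the wreath product of \<open>K\<close> by the symmetric group
  on \<open>I\<close>, with blocks \<open>carrier K\<close> times a point. The identity elsewhere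
  makes it a permutation in the sense of \<open>permutes\<close>.\<close>

definition expand_perm ::
    "('k, 'n) monoid_scheme \<Rightarrow> 'i set \<Rightarrow> ('i \<Rightarrow> 'i) \<Rightarrow> ('i \<Rightarrow> 'k) \<Rightarrow> 'k \<times> 'i \<Rightarrow> 'k \<times> 'i" where
  "expand_perm K I \<alpha> p =
     (\<lambda>(k, i). if k \<in> carrier K \<and> i \<in> I then (k \<otimes>\<^bsub>K\<^esub> p i, \<alpha> i) else (k, i))"

lemma expand_perm_permutes:
  assumes K: "group K" and \<alpha>: "\<alpha> permutes I" and p: "p \<in> I \<rightarrow> carrier K"
  shows "expand_perm K I \<alpha> p permutes carrier K \<times> I"
proof (rule bij_imp_permutes)
  interpret group K by fact
  have \<alpha>I: "\<alpha> i \<in> I" if "i \<in> I" for i using \<alpha> that by (simp add: permutes_in_image)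
  have \<alpha>'I: "inv_into UNIV \<alpha> i \<in> I" if "i \<in> I" for i
    using permutes_in_image [OF permutes_inv [OF \<alpha>]] that by simp
  have pK: "p i \<in> carrier K" if "i \<in> I" for i using p that by auto
  show "bij_betw (expand_perm K I \<alpha> p) (carrier K \<times> I) (carrier K \<times> I)"
  proof (rule bij_betw_byWitness
      [where f' = "\<lambda>(k, i). (k \<otimes>\<^bsub>K\<^esub> inv\<^bsub>K\<^esub> p (inv_into UNIV \<alpha> i), inv_into UNIV \<alpha> i)"])
  qed (auto simp: expand_perm_def \<alpha>I \<alpha>'I pK m_assoc permutes_inverses [OF \<alpha>])
qed (auto simp: expand_perm_def split: if_splits)

lemma Theta_mon:
  fixes K :: "('k, 'n) monoid_scheme"
  assumes K: "group K" and \<alpha>: "\<alpha> permutes I" and p: "p \<in> I \<rightarrow> carrier K" and r: "r \<in> I \<rightarrow> carrier K"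
  shows "Theta K I (mon K I \<alpha> p, mon K I \<beta> r) =
    (mon K (carrier K \<times> I) (expand_perm K I \<alpha> p) (\<lambda>_. \<one>\<^bsub>K\<^esub>),
     mon K (carrier K \<times> I) (expand_perm K I \<beta> (\<lambda>j. inv\<^bsub>K\<^esub> r j)) (\<lambda>_. \<one>\<^bsub>K\<^esub>))"
proof -
  \<comment> \<open>\<open>single\<close> is injective, so the entry quantified in
    \<open>Theta\<close> can only be the value of s at i, and the existential collapses.\<close>
  have iff: "(\<exists>a\<in>carrier K. mon K I \<gamma> s (i, i') = single a \<and> k' = f a) \<longleftrightarrow> k' = f (s i) \<and> i' = \<gamma> i"
    if "s \<in> I \<rightarrow> carrier K" "i \<in> I" "i' \<in> I" for \<gamma> s i i' and k' :: 'k and f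
    using that by (auto simp: mon_apply)
  show ?thesis
    unfolding Theta_def mon_def [of K "carrier K \<times> I"] split
    using p r
    by (auto intro!: restrict_ext simp: iff group_ring_one expand_perm_def)
qed

section \<open>\<open>Theta\<close> as an injective homomorphism\<close>

lemma expanded_mat_in_mats:
  assumes "group K" "M \<in> mats I (carrier K)"
  shows "expanded_mat K I M \<in> mats (carrier K \<times> I) (carrier K)"
proof -
  interpret group K by fact
  show ?thesis
    using assms(2) by (auto simp: expanded_mat_def mats_def)
qed

text \<open>The row label gains the factor \<open>p i\<close> and the column label the inverse of
  \<open>r j\<close>. Commutativity of \<open>K\<close> gathers both around the entry of
  \<open>M\<close> at \<open>(\<alpha> i, \<beta> j)\<close>, where the automorphism equation
  restores the entry at (i, j).\<close>

lemma Theta_closed: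
  assumes K: "comm_group K" and fin: "finite (carrier K)" and I: "finite I"
    and M: "M \<in> mats I (carrier K)" and g: "g \<in> carrier (Aut K I M)"
  shows "Theta K I g \<in> carrier (PAut K (carrier K \<times> I) (expanded_mat K I M))"
proof -
  interpret comm_group K by fact
  have K': "group K" ..
  obtain \<alpha> p \<beta> r where g_eq: "g = (mon K I \<alpha> p, mon K I \<beta> r)"
    and \<alpha>: "\<alpha> permutes I" and \<beta>: "\<beta> permutes I" and p: "p \<in> I \<rightarrow> carrier K" and r: "r \<in> I \<rightarrow> carrier K"
    using g by (rule AutE)
  have inv_r: "(\<lambda>j. inv\<^bsub>K\<^esub> (r j)) \<in> I \<rightarrow> carrier K" using r by auto
  have perm: "expand_perm K I \<alpha> p permutes carrier K \<times> I"
    "expand_perm K I \<beta> (\<lambda>j. inv\<^bsub>K\<^esub> (r j)) permutes carrier K \<times> I"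
    by (rule expand_perm_permutes [OF K' \<alpha> p] expand_perm_permutes [OF K' \<beta> inv_r])+
  have "expanded_mat K I M (expand_perm K I \<alpha> p (k, i), expand_perm K I \<beta> (\<lambda>j. inv\<^bsub>K\<^esub> (r j)) (l, j)) =
      expanded_mat K I M ((k, i), (l, j))"
    if k: "k \<in> carrier K" and i: "i \<in> I" and l: "l \<in> carrier K" and j: "j \<in> I" for k i l j
  proof -
    have I': "\<alpha> i \<in> I" "\<beta> j \<in> I" using i j \<alpha> \<beta> by (simp_all add: permutes_in_image)
    have cl: "p i \<in> carrier K" "r j \<in> carrier K" "M (i, j) \<in> carrier K" "M (\<alpha> i, \<beta> j) \<in> carrier K"
      using p r M i j I' by (auto simp: mats_def)
    have eq: "p i \<otimes>\<^bsub>K\<^esub> M (\<alpha> i, \<beta> j) = M (i, j) \<otimes>\<^bsub>K\<^esub> r j"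
      using g i j by (simp add: g_eq mon_in_Aut_iff [OF K' I \<alpha> p \<beta> r M])
    have "(k \<otimes>\<^bsub>K\<^esub> p i) \<otimes>\<^bsub>K\<^esub> (l \<otimes>\<^bsub>K\<^esub> inv\<^bsub>K\<^esub> (r j)) \<otimes>\<^bsub>K\<^esub> M (\<alpha> i, \<beta> j) =
        k \<otimes>\<^bsub>K\<^esub> l \<otimes>\<^bsub>K\<^esub> ((p i \<otimes>\<^bsub>K\<^esub> M (\<alpha> i, \<beta> j)) \<otimes>\<^bsub>K\<^esub> inv\<^bsub>K\<^esub> (r j))"
      using k l cl by (simp add: m_ac)
    also have "\<dots> = k \<otimes>\<^bsub>K\<^esub> l \<otimes>\<^bsub>K\<^esub> M (i, j)"
      using cl by (simp add: eq m_assoc)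
    finally show ?thesis
      using k i l j I' cl by (simp add: expand_perm_def expanded_mat_def)
  qed
  moreover have "expanded_mat K I M (x, y) \<in> carrier K" "x \<in> carrier K \<times> I \<Longrightarrow> expand_perm K I \<alpha> p x \<in> carrier K \<times> I"
    "y \<in> carrier K \<times> I \<Longrightarrow> expand_perm K I \<beta> (\<lambda>j. inv\<^bsub>K\<^esub> (r j)) y \<in> carrier K \<times> I"
    if "x \<in> carrier K \<times> I" "y \<in> carrier K \<times> I" for x y
    using expanded_mat_in_mats [OF K' M] that perm [THEN permutes_in_image]
    unfolding mats_def by blast+
  ultimately have "Theta K I g \<in> carrier (Aut K (carrier K \<times> I) (expanded_mat K I M))"
    unfolding g_eq Theta_mon [OF K' \<alpha> p r]
    by (subst mon_in_Aut_iff [OF K' finite_cartesian_product [OF fin I] perm(1) _ perm(2) _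
          expanded_mat_in_mats [OF K' M]]) auto
  then show ?thesis
    using perm unfolding g_eq Theta_mon [OF K' \<alpha> p r] PAut_carrier [OF K'] by blast
qed

lemma expand_perm_comp:
  assumes K: "group K" and \<alpha>: "\<alpha> permutes I" and p: "p \<in> I \<rightarrow> carrier K" "p' \<in> I \<rightarrow> carrier K"
  shows "expand_perm K I (\<alpha>' \<circ> \<alpha>) (\<lambda>i. p i \<otimes>\<^bsub>K\<^esub> p' (\<alpha> i)) = expand_perm K I \<alpha>' p' \<circ> expand_perm K I \<alpha> p"
proof
  interpret group K by fact
  have I': "\<alpha> i \<in> I" if "i \<in> I" for i using that \<alpha> by (simp add: permutes_in_image)
  have cl: "p i \<in> carrier K" "p' i \<in> carrier K" if "i \<in> I" for i using p that by auto
  fix x :: "'a \<times> 'c"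
  show "expand_perm K I (\<alpha>' \<circ> \<alpha>) (\<lambda>i. p i \<otimes>\<^bsub>K\<^esub> p' (\<alpha> i)) x = (expand_perm K I \<alpha>' p' \<circ> expand_perm K I \<alpha> p) x"
    by (cases x) (auto simp: expand_perm_def I' cl m_assoc)
qed

lemma Theta_hom:
  assumes K: "comm_group K" and fin: "finite (carrier K)" and I: "finite I"
    and M: "M \<in> mats I (carrier K)"
  shows "Theta K I \<in> hom (Aut K I M) (PAut K (carrier K \<times> I) (expanded_mat K I M))"
proof (rule homI)
  interpret comm_group K by fact
  have K': "group K" ..
  fix g h assume g: "g \<in> carrier (Aut K I M)" and h: "h \<in> carrier (Aut K I M)"
  show "Theta K I g \<in> carrier (PAut K (carrier K \<times> I) (expanded_mat K I M))"
    using assms g by (rule Theta_closed)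
  obtain \<alpha> p \<beta> r where g_eq: "g = (mon K I \<alpha> p, mon K I \<beta> r)"
    and \<alpha>: "\<alpha> permutes I" and \<beta>: "\<beta> permutes I" and p: "p \<in> I \<rightarrow> carrier K" and r: "r \<in> I \<rightarrow> carrier K"
    using g by (rule AutE)
  obtain \<alpha>' p' \<beta>' r' where h_eq: "h = (mon K I \<alpha>' p', mon K I \<beta>' r')"
    and \<alpha>': "\<alpha>' permutes I" and \<beta>': "\<beta>' permutes I"
    and p': "p' \<in> I \<rightarrow> carrier K" and r': "r' \<in> I \<rightarrow> carrier K"
    using h by (rule AutE)
  have inv_r: "(\<lambda>j. inv\<^bsub>K\<^esub> (r j)) \<in> I \<rightarrow> carrier K" "(\<lambda>j. inv\<^bsub>K\<^esub> (r' j)) \<in> I \<rightarrow> carrier K"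
    using r r' by auto
  \<comment> \<open>Column labels carry inverted entries, and inversion respects products in this
    order because \<open>K\<close> is commutative.\<close>
  have "expand_perm K I (\<beta>' \<circ> \<beta>) (\<lambda>j. inv\<^bsub>K\<^esub> (r j \<otimes>\<^bsub>K\<^esub> r' (\<beta> j))) =
      expand_perm K I (\<beta>' \<circ> \<beta>) (\<lambda>j. inv\<^bsub>K\<^esub> (r j) \<otimes>\<^bsub>K\<^esub> inv\<^bsub>K\<^esub> (r' (\<beta> j)))"
    using \<beta> r r' by (auto simp: expand_perm_def fun_eq_iff Pi_def permutes_in_image inv_mult)
  also have "\<dots> = expand_perm K I \<beta>' (\<lambda>j. inv\<^bsub>K\<^esub> (r' j)) \<circ> expand_perm K I \<beta> (\<lambda>j. inv\<^bsub>K\<^esub> (r j))"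
    by (rule expand_perm_comp [OF K' \<beta> inv_r])
  finally have Q: "expand_perm K I (\<beta>' \<circ> \<beta>) (\<lambda>j. inv\<^bsub>K\<^esub> (r j \<otimes>\<^bsub>K\<^esub> r' (\<beta> j))) = \<dots>" .
  have one: "(\<lambda>_. \<one>\<^bsub>K\<^esub>) \<in> carrier K \<times> I \<rightarrow> carrier K" by simp
  show "Theta K I (g \<otimes>\<^bsub>Aut K I M\<^esub> h) =
      Theta K I g \<otimes>\<^bsub>PAut K (carrier K \<times> I) (expanded_mat K I M)\<^esub> Theta K I h"
    unfolding g_eq h_eq Aut_mult_mon [OF K' I \<alpha> \<beta> p r p' r'] Theta_mon [OF K' \<alpha> p r]
      Theta_mon [OF K' \<alpha>' p' r']
      Theta_mon [OF K' permutes_compose [OF \<alpha> \<alpha>'] mon_mult_closed [OF K' \<alpha> p p'] mon_mult_closed [OF K' \<beta> r r']]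
      expand_perm_comp [OF K' \<alpha> p p'] Q
    using K' fin I expand_perm_permutes [OF K' \<alpha> p] expand_perm_permutes [OF K' \<beta> inv_r(1)]
    by (simp add: PAut_def Aut_mult_mon)
qed

text \<open>The image of the label with first component one consists of the entry and the permuted
  index.\<close>

lemma expand_perm_inject:
  assumes K: "group K" and p: "p \<in> I \<rightarrow> carrier K" "p' \<in> I \<rightarrow> carrier K"
    and eq: "expand_perm K I \<alpha> p = expand_perm K I \<alpha>' p'" and i: "i \<in> I"
  shows "\<alpha> i = \<alpha>' i \<and> p i = p' i"
proof -
  interpret group K by fact
  show ?thesis
    using fun_cong [OF eq, of "(\<one>\<^bsub>K\<^esub>, i)"] p i by (auto simp: expand_perm_def Pi_def)
qed

lemma Theta_inj:
  assumes K: "group K"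
  shows "inj_on (Theta K I) (carrier (Aut K I M))"
proof (rule inj_onI)
  interpret group K by fact
  fix g h assume g: "g \<in> carrier (Aut K I M)" and h: "h \<in> carrier (Aut K I M)"
    and eq: "Theta K I g = Theta K I h"
  obtain \<alpha> p \<beta> r where g_eq: "g = (mon K I \<alpha> p, mon K I \<beta> r)"
    and \<alpha>: "\<alpha> permutes I" and \<beta>: "\<beta> permutes I" and p: "p \<in> I \<rightarrow> carrier K" and r: "r \<in> I \<rightarrow> carrier K"
    using g by (rule AutE)
  obtain \<alpha>' p' \<beta>' r' where h_eq: "h = (mon K I \<alpha>' p', mon K I \<beta>' r')"
    and \<alpha>': "\<alpha>' permutes I" and \<beta>': "\<beta>' permutes I"
    and p': "p' \<in> I \<rightarrow> carrier K" and r': "r' \<in> I \<rightarrow> carrier K"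
    using h by (rule AutE)
  have inv_r: "(\<lambda>j. inv\<^bsub>K\<^esub> (r j)) \<in> I \<rightarrow> carrier K" "(\<lambda>j. inv\<^bsub>K\<^esub> (r' j)) \<in> I \<rightarrow> carrier K"
    using r r' by auto
  note perms = expand_perm_permutes [OF K \<alpha> p] expand_perm_permutes [OF K \<alpha>' p']
    expand_perm_permutes [OF K \<beta> inv_r(1)] expand_perm_permutes [OF K \<beta>' inv_r(2)]
  have P: "expand_perm K I \<alpha> p = expand_perm K I \<alpha>' p'"
    and Q: "expand_perm K I \<beta> (\<lambda>j. inv\<^bsub>K\<^esub> (r j)) = expand_perm K I \<beta>' (\<lambda>j. inv\<^bsub>K\<^esub> (r' j))"
    using eq by (simp_all add: g_eq h_eq Theta_mon [OF K \<alpha> p r] Theta_mon [OF K \<alpha>' p' r']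
        mon_eq_iff [OF perms(1,2)] mon_eq_iff [OF perms(3,4)])
  have "inv\<^bsub>K\<^esub> (r i) = inv\<^bsub>K\<^esub> (r' i) \<Longrightarrow> r i = r' i" if "i \<in> I" for i
    using r r' that by (metis PiE inv_inv)
  then show "g = h"
    using expand_perm_inject [OF K p p' P] expand_perm_inject [OF K inv_r Q]
    by (auto simp: g_eq h_eq intro!: mon_cong)
qed

section \<open>Generalized Hadamard codes\<close>

text \<open>\<open>K\<close> is assumed to be a group only; its commutativity and finiteness are
  inherited from \<open>F\<close> through \<phi>.\<close>

locale gh_matrix =
  fixes F :: "('a, 'm) ring_scheme" (structure) and K :: "('k, 'n) monoid_scheme"
    and v :: nat and H :: "nat \<times> nat \<Rightarrow> 'a" and \<phi> :: "'a \<Rightarrow> 'k"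
  assumes field_F: "field F" and finite_F: "finite (carrier F)"
    and gh: "gen_hadamard F v H" and norm: "normalized F v H"
    and group_K: "group K" and iso: "\<phi> \<in> iso (add_monoid F) K"
begin

sublocale F: field F by (fact field_F)
sublocale K: group K by (fact group_K)

definition I :: "nat set" where "I = {1..v}"
abbreviation M :: "nat \<times> nat \<Rightarrow> 'k" where "M \<equiv> map_mat I \<phi> H"
abbreviation E :: "('k \<times> nat) set" where "E \<equiv> carrier K \<times> I"
abbreviation C :: "(nat \<Rightarrow> 'a) set" where "C \<equiv> gh_code F v H"

lemma finite_I [simp]: "finite I"
  by (simp add: I_def)

lemma one_in_I: "1 \<in> I"
  using gh by (simp add: I_def gen_hadamard_def)

lemma H_closed [simp]: "i \<in> I \<Longrightarrow> j \<in> I \<Longrightarrow> H (i, j) \<in> carrier F"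
  using gh by (auto simp: I_def gen_hadamard_def mats_def)

lemma H_one: "i \<in> I \<Longrightarrow> H (1, i) = \<zero>" "i \<in> I \<Longrightarrow> H (i, 1) = \<zero>"
  using norm by (auto simp: I_def normalized_def)

section \<open>Transfer along the isomorphism \<open>\<phi>\<close>\<close>

lemma phi_bij: "bij_betw \<phi> (carrier F) (carrier K)"
  using iso by (simp add: iso_def)

lemma phi_closed [simp]: "a \<in> carrier F \<Longrightarrow> \<phi> a \<in> carrier K"
  using phi_bij by (auto simp: bij_betw_def)

lemma phi_eq_iff: "a \<in> carrier F \<Longrightarrow> b \<in> carrier F \<Longrightarrow> \<phi> a = \<phi> b \<longleftrightarrow> a = b"
  using phi_bij by (auto simp: bij_betw_def dest: inj_onD)

lemma phi_add: "a \<in> carrier F \<Longrightarrow> b \<in> carrier F \<Longrightarrow> \<phi> (a \<oplus> b) = \<phi> a \<otimes>\<^bsub>K\<^esub> \<phi> b"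
  using iso by (auto simp: iso_def hom_def)

lemma phiE:
  assumes "k \<in> carrier K"
  obtains a where "a \<in> carrier F" "k = \<phi> a"
  using phi_bij assms by (auto simp: bij_betw_def)

lemma phi_zero: "\<phi> \<zero> = \<one>\<^bsub>K\<^esub>"
  using phi_add [of \<zero> \<zero>] by (simp add: K.l_cancel_one')

lemma comm_group_K: "comm_group K"
proof (rule K.group_comm_groupI)
  fix x y assume "x \<in> carrier K" "y \<in> carrier K"
  then show "x \<otimes>\<^bsub>K\<^esub> y = y \<otimes>\<^bsub>K\<^esub> x"
    by (elim phiE) (simp flip: phi_add add: F.add.m_comm)
qed

lemma finite_K: "finite (carrier K)"
  using finite_F bij_betw_finite [OF phi_bij] by simp

lemma M_in_mats: "M \<in> mats I (carrier K)"
  by (auto simp: mats_def map_mat_def)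

text \<open>The difference of two distinct rows takes every value of the field, whereas the
  hypothesis makes it constantly d - c. So the rows coincide, and then so do the constants.\<close>

lemma translated_rows_distinct:
  assumes i: "i \<in> I" and j: "j \<in> I" and c: "c \<in> carrier F" and d: "d \<in> carrier F"
    and eq: "\<And>k. k \<in> I \<Longrightarrow> H (i, k) \<oplus> c = H (j, k) \<oplus> d"
  shows "i = j \<and> c = d"
proof -
  have less: False if i: "i \<in> I" and j: "j \<in> I" and c: "c \<in> carrier F" and d: "d \<in> carrier F"
    and eq: "\<And>k. k \<in> I \<Longrightarrow> H (i, k) \<oplus> c = H (j, k) \<oplus> d" and "i < j" for i j c d
  proof -
    \<comment> \<open>Any second value would do; adding one gives it, as one differs from zero in a
      field. Being a value of the field it must occur \<open>v div order F\<close> times, a positive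
      number because the order divides \<open>v\<close>.\<close>
    have "d \<ominus> c \<oplus> \<one> \<noteq> d \<ominus> c" using c d by simp
    moreover have "H (i, k) \<ominus> H (j, k) = d \<ominus> c" if k: "k \<in> I" for k
    proof -
      have "H (i, k) = H (j, k) \<oplus> d \<ominus> c"
        using eq i j c d k by (metis F.add.inv_solve_right F.minus_eq F.add.m_closed H_closed)
      then show ?thesis
        using i j c d k by (simp add: F.minus_eq F.add.m_ac F.r_neg1 F.r_neg)
    qed
    ultimately have "{k \<in> I. H (i, k) \<ominus> H (j, k) = d \<ominus> c \<oplus> \<one>} = {}"
      by auto
    moreover have "card {k \<in> I. H (i, k) \<ominus> H (j, k) = d \<ominus> c \<oplus> \<one>} = v div order F"
      using gh i j \<open>i < j\<close> F.minus_closed [OF d c] unfolding I_def gen_hadamard_def by blast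
    moreover have "v div order F > 0"
      using gh finite_F F.zero_closed
      by (auto simp: gen_hadamard_def order_def card_gt_0_iff dvd_div_eq_0_iff intro!: Nat.gr0I)
    ultimately show False by (metis card.empty less_irrefl)
  qed
  have "i = j"
    using less [OF i j c d eq] less [OF j i d c eq [symmetric]] by (meson linorder_less_linear)
  then show ?thesis
    \<comment> \<open>Column 1 of a normalized matrix is zero, so coordinate 1 reads c = d
      directly.\<close>
    using eq [OF one_in_I] i j c d by (simp add: H_one del: One_nat_def)
qed

section \<open>Codewords and their parameters\<close>

definition cw :: "'a \<Rightarrow> nat \<Rightarrow> nat \<Rightarrow> 'a" where
  "cw a i = (\<lambda>j\<in>I. H (i, j) \<oplus> a)"

lemma cw_apply [simp]: "j \<in> I \<Longrightarrow> cw a i j = H (i, j) \<oplus> a"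
  by (simp add: cw_def)

lemma code_eq: "C = {cw a i |a i. a \<in> carrier F \<and> i \<in> I}"
proof -
  have "word_add F v (\<lambda>j\<in>I. H (i, j)) (const_word v a) = cw a i" for a i
    by (auto simp: word_add_def const_word_def cw_def I_def intro!: restrict_ext)
  then show ?thesis
    unfolding gh_code_def mat_rows_def I_def [symmetric] image_image by auto
qed

lemma cw_in_code [intro]: "a \<in> carrier F \<Longrightarrow> i \<in> I \<Longrightarrow> cw a i \<in> C"
  by (auto simp: code_eq)

text \<open>Row 1 of a normalized matrix is zero. Thus constant words lie in the code, and the zero
  word \<open>cw \<zero> 1\<close> can serve as base point.\<close>

lemma cw_one: "cw a 1 = const_word v a" if "a \<in> carrier F"
  unfolding cw_def const_word_def I_def [symmetric]
  using that by (auto simp: H_one simp del: One_nat_def intro!: restrict_ext)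

lemma cw_eq_iff:
  assumes "a \<in> carrier F" "b \<in> carrier F" "i \<in> I" "j \<in> I"
  shows "cw a i = cw b j \<longleftrightarrow> a = b \<and> i = j"
proof
  assume eq: "cw a i = cw b j"
  have "H (i, k) \<oplus> a = H (j, k) \<oplus> b" if "k \<in> I" for k
    using fun_cong [OF eq, of k] that by simp
  then have "i = j \<and> a = b"
    by (rule translated_rows_distinct [OF assms(3,4,1,2)])
  then show "a = b \<and> i = j" by simp
qed auto

lemma code_in_words: "C \<subseteq> words F v"
  unfolding words_def I_def [symmetric] by (auto simp: code_eq cw_def)

lemma card_code: "card C = card E"
proof -
  have "C = (\<lambda>(a, i). cw a i) ` (carrier F \<times> I)"
    by (auto simp: code_eq)
  moreover have "inj_on (\<lambda>(a, i). cw a i) (carrier F \<times> I)"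
    by (auto simp: inj_on_def cw_eq_iff)
  ultimately show ?thesis
    using bij_betw_same_card [OF phi_bij] by (simp add: card_image card_cartesian_product)
qed

text \<open>Monomial matrices and automorphisms, with the nonzero entries pulled back to \<open>F\<close> along \<open>\<phi>\<close>.\<close>

definition emon :: "(nat \<Rightarrow> nat) \<Rightarrow> (nat \<Rightarrow> 'a) \<Rightarrow> (nat \<times> nat \<Rightarrow> 'k \<Rightarrow> int)" where
  "emon \<alpha> p = mon K I \<alpha> (\<lambda>i. \<phi> (p i))"

definition aut :: "(nat \<Rightarrow> nat) \<Rightarrow> (nat \<Rightarrow> 'a) \<Rightarrow> (nat \<Rightarrow> nat) \<Rightarrow> (nat \<Rightarrow> 'a) \<Rightarrow> bool" where
  "aut \<alpha> p \<beta> r \<longleftrightarrow>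
     \<alpha> permutes I \<and> p \<in> I \<rightarrow> carrier F \<and> \<beta> permutes I \<and> r \<in> I \<rightarrow> carrier F \<and>
     (\<forall>i\<in>I. \<forall>j\<in>I. p i \<oplus> H (\<alpha> i, \<beta> j) = H (i, j) \<oplus> r j)"

lemma phi_comp_closed: "p \<in> I \<rightarrow> carrier F \<Longrightarrow> (\<lambda>i. \<phi> (p i)) \<in> I \<rightarrow> carrier K"
  by (simp add: Pi_def)

lemma emon_cong: "(\<And>i. i \<in> I \<Longrightarrow> \<alpha> i = \<beta> i) \<Longrightarrow> (\<And>i. i \<in> I \<Longrightarrow> p i = r i) \<Longrightarrow> emon \<alpha> p = emon \<beta> r"
  unfolding emon_def by (rule mon_cong) auto

lemma emon_eq_iff:
  assumes "\<alpha> permutes I" "\<beta> permutes I" "p \<in> I \<rightarrow> carrier F" "r \<in> I \<rightarrow> carrier F"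
  shows "emon \<alpha> p = emon \<beta> r \<longleftrightarrow> \<alpha> = \<beta> \<and> (\<forall>i\<in>I. p i = r i)"
  using assms(3,4) by (auto simp: emon_def mon_eq_iff [OF assms(1,2)] Pi_def phi_eq_iff)

lemma emon_mult:
  assumes "\<alpha> permutes I" "p \<in> I \<rightarrow> carrier F" "r \<in> I \<rightarrow> carrier F"
  shows "mat_mult (group_ring K) I (emon \<alpha> p) (emon \<beta> r) = emon (\<beta> \<circ> \<alpha>) (\<lambda>i. p i \<oplus> r (\<alpha> i))"
  using assms unfolding emon_def
  by (subst mat_mult_mon [OF group_K _ assms(1)])
    (auto simp: Pi_def permutes_in_image phi_add intro!: mon_cong)

lemma emon_in_Aut_iff:
  assumes "\<alpha> permutes I" "p \<in> I \<rightarrow> carrier F" "\<beta> permutes I" "r \<in> I \<rightarrow> carrier F"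
  shows "(emon \<alpha> p, emon \<beta> r) \<in> carrier (Aut K I M) \<longleftrightarrow> aut \<alpha> p \<beta> r"
proof -
  have "(emon \<alpha> p, emon \<beta> r) \<in> carrier (Aut K I M) \<longleftrightarrow>
      (\<forall>i\<in>I. \<forall>j\<in>I. \<phi> (p i) \<otimes>\<^bsub>K\<^esub> M (\<alpha> i, \<beta> j) = M (i, j) \<otimes>\<^bsub>K\<^esub> \<phi> (r j))"
    unfolding emon_def
    by (rule mon_in_Aut_iff [OF group_K _ assms(1) phi_comp_closed [OF assms(2)] assms(3)
          phi_comp_closed [OF assms(4)] M_in_mats]) simp
  also have "\<dots> \<longleftrightarrow> (\<forall>i\<in>I. \<forall>j\<in>I. p i \<oplus> H (\<alpha> i, \<beta> j) = H (i, j) \<oplus> r j)"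
  proof (intro ball_cong refl)
    fix i j assume ij: "i \<in> I" "j \<in> I"
    then have I': "\<alpha> i \<in> I" "\<beta> j \<in> I" using assms by (simp_all only: permutes_in_image)
    have "p i \<in> carrier F" "r j \<in> carrier F" using ij assms by auto
    then have "\<phi> (p i) \<otimes>\<^bsub>K\<^esub> M (\<alpha> i, \<beta> j) = \<phi> (p i \<oplus> H (\<alpha> i, \<beta> j))"
      "M (i, j) \<otimes>\<^bsub>K\<^esub> \<phi> (r j) = \<phi> (H (i, j) \<oplus> r j)"
      using ij I' by (simp_all add: phi_add map_mat_def del: atLeastAtMost_iff)
    then show "\<phi> (p i) \<otimes>\<^bsub>K\<^esub> M (\<alpha> i, \<beta> j) = M (i, j) \<otimes>\<^bsub>K\<^esub> \<phi> (r j) \<longleftrightarrow>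
        p i \<oplus> H (\<alpha> i, \<beta> j) = H (i, j) \<oplus> r j"
      using ij I' \<open>p i \<in> carrier F\<close> \<open>r j \<in> carrier F\<close>
      by (simp add: phi_eq_iff)
  qed
  finally show ?thesis using assms by (simp add: aut_def)
qed

lemma emonE:
  assumes "p \<in> I \<rightarrow> carrier K"
  obtains p' where "p' \<in> I \<rightarrow> carrier F" "mon K I \<alpha> p = emon \<alpha> p'"
proof
  let ?p = "\<lambda>i. inv_into (carrier F) \<phi> (p i)"
  have "p i \<in> \<phi> ` carrier F" if "i \<in> I" for i
    using assms that phi_bij by (auto simp: bij_betw_def)
  then show "?p \<in> I \<rightarrow> carrier F" "mon K I \<alpha> p = emon \<alpha> ?p"
    by (auto simp: emon_def f_inv_into_f inv_into_into intro!: mon_cong)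
qed

lemma Aut_emonE:
  assumes g: "g \<in> carrier (Aut K I M)"
  obtains \<alpha> p \<beta> r where "aut \<alpha> p \<beta> r" "g = (emon \<alpha> p, emon \<beta> r)"
proof -
  obtain \<alpha> p \<beta> r where g_eq: "g = (mon K I \<alpha> p, mon K I \<beta> r)"
    and \<alpha>: "\<alpha> permutes I" and \<beta>: "\<beta> permutes I" and p: "p \<in> I \<rightarrow> carrier K" and r: "r \<in> I \<rightarrow> carrier K"
    using g by (rule AutE)
  obtain p' where p': "p' \<in> I \<rightarrow> carrier F" "mon K I \<alpha> p = emon \<alpha> p'" by (rule emonE [OF p])
  obtain r' where r': "r' \<in> I \<rightarrow> carrier F" "mon K I \<beta> r = emon \<beta> r'" by (rule emonE [OF r])
  have "aut \<alpha> p' \<beta> r'"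
    using g emon_in_Aut_iff [OF \<alpha> p'(1) \<beta> r'(1)] by (simp add: g_eq p'(2) r'(2))
  then show ?thesis by (rule that) (simp add: g_eq p'(2) r'(2))
qed

lemma aut_in_Aut: "aut \<alpha> p \<beta> r \<Longrightarrow> (emon \<alpha> p, emon \<beta> r) \<in> carrier (Aut K I M)"
  by (subst emon_in_Aut_iff) (auto simp: aut_def)

text \<open>The rows of \<open>H\<close> are distinct modulo constants, so \<open>P\<close> is determined by \<open>Q\<close>.\<close>

lemma aut_unique:
  assumes "aut \<alpha> p \<beta> r" "aut \<alpha>' p' \<beta> r" and i: "i \<in> I"
  shows "\<alpha> i = \<alpha>' i \<and> p i = p' i"
proof -
  have \<alpha>: "\<alpha> i \<in> I" "\<alpha>' i \<in> I" and \<beta>: "\<beta> permutes I" and p: "p i \<in> carrier F" "p' i \<in> carrier F"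
    using assms by (auto simp: aut_def permutes_in_image)
  have "H (\<alpha> i, k) \<oplus> p i = H (\<alpha>' i, k) \<oplus> p' i" if k: "k \<in> I" for k
  proof -
    \<comment> \<open>As \<beta> is onto, the equations at all j compare the two rows in every
      coordinate.\<close>
    obtain j where j: "j \<in> I" "k = \<beta> j"
      using permutes_image [OF \<beta>] k by blast
    have "p i \<oplus> H (\<alpha> i, k) = p' i \<oplus> H (\<alpha>' i, k)"
      using assms j by (simp add: aut_def)
    then show ?thesis using \<alpha> p k by (simp add: F.add.m_comm)
  qed
  then show ?thesis
    by (rule translated_rows_distinct [OF \<alpha> p])
qed

text \<open>The column part determines the row part. This allows identities to be checked where the
  propelinear data, a permutation and a word, are visible.\<close>

lemma Aut_eqI:
  assumes g: "g \<in> carrier (Aut K I M)" and h: "h \<in> carrier (Aut K I M)" and eq: "snd g = snd h"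
  shows "g = h"
proof -
  obtain \<alpha> p \<beta> r where a: "aut \<alpha> p \<beta> r" and g_eq: "g = (emon \<alpha> p, emon \<beta> r)"
    using g by (rule Aut_emonE)
  obtain \<alpha>' p' \<beta>' r' where a': "aut \<alpha>' p' \<beta>' r'" and h_eq: "h = (emon \<alpha>' p', emon \<beta>' r')"
    using h by (rule Aut_emonE)
  have "\<beta> = \<beta>'" "\<forall>j\<in>I. r j = r' j"
    using eq emon_eq_iff [of \<beta> \<beta>' r r'] a a' by (auto simp: g_eq h_eq aut_def)
  then have "aut \<alpha>' p' \<beta> r" using a a' by (auto simp: aut_def)
  then have "\<forall>i\<in>I. \<alpha> i = \<alpha>' i \<and> p i = p' i" using aut_unique [OF a] by blast
  then have "emon \<alpha> p = emon \<alpha>' p'" by (intro emon_cong) auto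
  then show ?thesis using eq by (simp add: g_eq h_eq)
qed

text \<open>\<open>perm_of\<close> inverts, so the question is whether the expanded permutation
  sends \<open>(\<phi> y, j)\<close> to \<open>(\<phi> x, i)\<close>. If
  \<open>(\<phi> a, i)\<close> is read as the label of \<open>cw a i\<close>, this is the map on
  codewords in \<open>aut_cw\<close>.\<close>

lemma Theta_rows:
  assumes a: "aut \<alpha> p \<beta> r" and "x \<in> carrier F" "y \<in> carrier F" "i \<in> I" "j \<in> I"
  shows "perm_of K E (fst (Theta K I (emon \<alpha> p, emon \<beta> r))) (\<phi> x, i) = (\<phi> y, j) \<longleftrightarrow>
    \<alpha> j = i \<and> y \<oplus> p j = x"
proof -
  have \<alpha>: "\<alpha> permutes I" and p: "p \<in> I \<rightarrow> carrier F" "p j \<in> carrier F" and r: "r \<in> I \<rightarrow> carrier F"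
    using assms by (auto simp: aut_def)
  have "perm_of K E (fst (Theta K I (emon \<alpha> p, emon \<beta> r))) (\<phi> x, i) = (\<phi> y, j) \<longleftrightarrow>
      expand_perm K I \<alpha> (\<lambda>i. \<phi> (p i)) (\<phi> y, j) = (\<phi> x, i)"
    using assms
    by (simp add: emon_def Theta_mon [OF group_K \<alpha> phi_comp_closed [OF p(1)] phi_comp_closed [OF r]]
        perm_of_mon_eq_iff [OF expand_perm_permutes [OF group_K \<alpha> phi_comp_closed [OF p(1)]]])
  then show ?thesis
    using assms p by (auto simp: expand_perm_def phi_eq_iff simp flip: phi_add)
qed

lemma phi_a_inv: "a \<in> carrier F \<Longrightarrow> inv\<^bsub>K\<^esub> (\<phi> a) = \<phi> (\<ominus> a)"
  by (rule K.inv_equality) (simp_all add: F.l_neg phi_zero flip: phi_add)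

text \<open>The inverse in the column part of \<open>Theta\<close> and the inversion in
  \<open>perm_of\<close> cancel, which leaves the addition of \<open>r j\<close>.\<close>

lemma Theta_cols:
  assumes a: "aut \<alpha> p \<beta> r" and "x \<in> carrier F" "y \<in> carrier F" "i \<in> I" "j \<in> I"
  shows "perm_of K E (snd (Theta K I (emon \<alpha> p, emon \<beta> r))) (\<phi> x, i) = (\<phi> y, j) \<longleftrightarrow>
    \<beta> j = i \<and> y = x \<oplus> r j"
proof -
  have \<alpha>: "\<alpha> permutes I" and \<beta>: "\<beta> permutes I" and p: "p \<in> I \<rightarrow> carrier F"
    and r: "r \<in> I \<rightarrow> carrier F" "r j \<in> carrier F"
    using assms by (auto simp: aut_def)
  have inv_r: "(\<lambda>j. inv\<^bsub>K\<^esub> (\<phi> (r j))) \<in> I \<rightarrow> carrier K"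
    using r by (simp add: Pi_def)
  have "perm_of K E (snd (Theta K I (emon \<alpha> p, emon \<beta> r))) (\<phi> x, i) = (\<phi> y, j) \<longleftrightarrow>
      expand_perm K I \<beta> (\<lambda>j. inv\<^bsub>K\<^esub> (\<phi> (r j))) (\<phi> y, j) = (\<phi> x, i)"
    using assms
    by (simp add: emon_def Theta_mon [OF group_K \<alpha> phi_comp_closed [OF p] phi_comp_closed [OF r(1)]]
        perm_of_mon_eq_iff [OF expand_perm_permutes [OF group_K \<beta> inv_r]])
  also have "\<dots> \<longleftrightarrow> \<beta> j = i \<and> y \<ominus> r j = x"
    using assms r by (auto simp: expand_perm_def phi_eq_iff phi_a_inv F.minus_eq simp flip: phi_add)
  also have "y \<ominus> r j = x \<longleftrightarrow> y = x \<oplus> r j"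
    using assms r F.add.inv_solve_right' [of x y "r j"] by (auto simp: F.minus_eq)
  finally show ?thesis .
qed

section \<open>Words of the code and scalar pairs\<close>

lemma code_closed [simp]: "x \<in> C \<Longrightarrow> j \<in> I \<Longrightarrow> x j \<in> carrier F"
  using code_in_words unfolding words_def I_def [symmetric] by (meson PiE_mem subsetD)

lemma code_eqI: "x \<in> C \<Longrightarrow> y \<in> C \<Longrightarrow> (\<And>j. j \<in> I \<Longrightarrow> x j = y j) \<Longrightarrow> x = y"
  using code_in_words unfolding words_def I_def [symmetric] by (meson PiE_ext subsetD)

lemma const_word_in_code: "c \<in> carrier F \<Longrightarrow> const_word v c \<in> C"
  using cw_in_code [OF _ one_in_I] cw_one by metis

lemma expanded_indexE:
  assumes "e \<in> E"
  obtains c i where "c \<in> carrier F" "i \<in> I" "e = (\<phi> c, i)"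
proof -
  obtain k i where "e = (k, i)" "k \<in> carrier K" "i \<in> I" using assms by blast
  moreover obtain c where "c \<in> carrier F" "k = \<phi> c" using \<open>k \<in> carrier K\<close> by (rule phiE)
  ultimately show ?thesis by (intro that) auto
qed

lemma star_eq: "star F v \<pi> x y = (\<lambda>j\<in>I. x j \<oplus> y (inv_into UNIV (\<pi> x) j))"
  by (simp add: star_def word_add_def permute_word_def I_def restrict_def fun_eq_iff)

lemma scalar_pairs_eq: "scalar_pairs K I = (\<lambda>c. (emon id (\<lambda>_. c), emon id (\<lambda>_. c))) ` carrier F"
proof -
  have "carrier K = \<phi> ` carrier F"
    using phi_bij by (simp add: bij_betw_def)
  then show ?thesis
    by (simp add: scalar_pairs_def scalar_mat_mon emon_def image_image)
qed

lemma aut_scalar: "c \<in> carrier F \<Longrightarrow> aut id (\<lambda>_. c) id (\<lambda>_. c)"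
  by (auto simp: aut_def F.add.m_comm)

text \<open>An automorphism acts on the code by permuting coordinates and translating.\<close>

lemma aut_cw:
  assumes a: "aut \<alpha> p \<beta> r" and x: "x \<in> carrier F" and i: "i \<in> I" and j: "j \<in> I"
  shows "\<ominus> r j \<oplus> cw x (\<alpha> i) (\<beta> j) = cw (x \<ominus> p i) i j"
proof -
  have I': "\<alpha> i \<in> I" "\<beta> j \<in> I" and cl: "p i \<in> carrier F" "r j \<in> carrier F"
    and eq: "p i \<oplus> H (\<alpha> i, \<beta> j) = H (i, j) \<oplus> r j"
    using a i j by (auto simp: aut_def permutes_in_image)
  \<comment> \<open>With x written as \<open>p i\<close> plus z, the left side of the automorphism
    equation appears inside the shifted entry.\<close>
  define z where "z = x \<ominus> p i"
  have z: "z \<in> carrier F" "x = p i \<oplus> z"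
    using x cl by (simp_all add: z_def F.minus_eq F.add.m_lcomm F.r_neg)
  have "H (\<alpha> i, \<beta> j) \<oplus> x = (p i \<oplus> H (\<alpha> i, \<beta> j)) \<oplus> z"
    using I' cl z(1) by (simp add: z(2) F.add.m_ac)
  also have "\<dots> = r j \<oplus> (H (i, j) \<oplus> z)"
    using i j cl z(1) by (simp add: eq F.add.m_ac)
  finally show ?thesis
    using i j I' cl z(1) by (simp add: z_def [symmetric] F.r_neg1)
qed

lemma snd_Aut_mult: "snd (g \<otimes>\<^bsub>Aut K I M\<^esub> h) = mat_mult (group_ring K) I (snd g) (snd h)"
  by (cases g, cases h) (simp add: Aut_mult)

text \<open>Each row i of \<open>H\<close> is sent to a codeword, that is, to a row
  \<open>a i\<close> plus a constant \<open>c i\<close>. The map a is injective since distinct rows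
  do not differ by a constant, hence a permutation of the finite set \<open>I\<close>; \<alpha> is
  its inverse and p the negated constants.\<close>

lemma ex_aut_of_code_isometry:
  assumes x: "x \<in> C" and \<beta>: "\<beta> permutes I"
    and closed: "\<And>y. y \<in> C \<Longrightarrow> (\<lambda>j\<in>I. x j \<oplus> y (\<beta> j)) \<in> C"
  shows "\<exists>\<alpha> p. aut \<alpha> p \<beta> (\<lambda>j. \<ominus> x j)"
proof -
  have "\<exists>c k. c \<in> carrier F \<and> k \<in> I \<and> (\<lambda>j\<in>I. x j \<oplus> cw \<zero> i (\<beta> j)) = cw c k" if "i \<in> I" for i
    using closed [OF cw_in_code [OF F.zero_closed that]] by (auto simp: code_eq)
  then obtain c a where ca: "\<And>i. i \<in> I \<Longrightarrow> c i \<in> carrier F \<and> a i \<in> I \<and>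
      (\<lambda>j\<in>I. x j \<oplus> cw \<zero> i (\<beta> j)) = cw (c i) (a i)"
    by metis
  have \<beta>I: "\<beta> j \<in> I" if "j \<in> I" for j using that \<beta> by (simp add: permutes_in_image)
  have cl: "c i \<in> carrier F" "a i \<in> I" if "i \<in> I" for i using ca that by auto
  have eq: "x j \<oplus> H (i, \<beta> j) = H (a i, j) \<oplus> c i" if i: "i \<in> I" and j: "j \<in> I" for i j
    using fun_cong [OF ca [OF i, THEN conjunct2, THEN conjunct2], of j] i j \<beta>I by simp
  have solve: "H (i, \<beta> j) = c i \<oplus> (H (a i, j) \<oplus> \<ominus> x j)" if i: "i \<in> I" and j: "j \<in> I" for i j
  proof -
    have "H (i, \<beta> j) = \<ominus> x j \<oplus> (x j \<oplus> H (i, \<beta> j))"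
      using x i j \<beta>I by (simp add: F.r_neg1)
    then show ?thesis
      using x i j \<beta>I cl by (simp add: eq F.add.m_ac)
  qed
  have inj: "inj_on a I"
  proof (rule inj_onI)
    fix i i' assume i: "i \<in> I" and i': "i' \<in> I" and same: "a i = a i'"
    \<comment> \<open>If both rows land on the same row, they differ only by their constants;
      crossing the constants over avoids a subtraction.\<close>
    have "H (i, k) \<oplus> c i' = H (i', k) \<oplus> c i" if k: "k \<in> I" for k
    proof -
      obtain j where j: "j \<in> I" "k = \<beta> j"
        using permutes_image [OF \<beta>] k by (metis imageE)
      show ?thesis
        using x i i' j cl by (simp add: solve same F.add.m_ac)
    qed
    then show "i = i'"
      using translated_rows_distinct [OF i i' cl(1) [OF i'] cl(1) [OF i]] by blast
  qed
  define a' where "a' i = (if i \<in> I then a i else i)" for i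
  have "bij_betw a' I I"
    using inj cl endo_inj_surj [OF finite_I _ inj]
    by (auto simp: bij_betw_def a'_def inj_on_def image_subset_iff)
  then have a': "a' permutes I"
    by (rule bij_imp_permutes) (simp add: a'_def)
  \<comment> \<open>An automorphism sends row \<open>\<alpha> i\<close> to row i up to a constant,
    so \<alpha> has to undo a.\<close>
  define \<alpha> where "\<alpha> = inv_into UNIV a'"
  have \<alpha>: "\<alpha> permutes I" using a' by (simp add: \<alpha>_def permutes_inv)
  have \<alpha>I: "\<alpha> i \<in> I" "a (\<alpha> i) = i" if "i \<in> I" for i
  proof -
    show "\<alpha> i \<in> I" using that \<alpha> by (simp add: permutes_in_image)
    moreover have "a' (\<alpha> i) = i" using a' by (simp add: \<alpha>_def permutes_inverses)
    ultimately show "a (\<alpha> i) = i" by (simp add: a'_def)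
  qed
  have "aut \<alpha> (\<lambda>i. \<ominus> c (\<alpha> i)) \<beta> (\<lambda>j. \<ominus> x j)"
    using \<alpha> \<beta> x cl \<alpha>I by (simp add: aut_def Pi_def solve F.r_neg1)
  then show ?thesis by blast
qed

section \<open>Propelinear structures and regular subgroups\<close>

text \<open>Freeness together with the count \<open>card C = card E\<close> gives regularity on rows and columns alike.\<close>

lemma propelinear_imp_regular:
  assumes "full_propelinear F v C"
  shows "\<exists>R. subgroup R (Aut K I M) \<and> scalar_pairs K I \<subseteq> R \<and>
    regular_subgroup K E (expanded_mat K I M) (Theta K I ` R)"
proof -
  obtain \<pi> where \<pi>: "\<forall>x\<in>C. \<pi> x permutes I" "\<forall>x\<in>C. star F v \<pi> x ` C = C"
      "\<forall>x\<in>C. \<forall>y\<in>C. \<pi> (star F v \<pi> x y) = \<pi> x \<circ> \<pi> y"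
      "\<forall>x\<in>C. if x \<in> const_words F v then \<pi> x = id else \<forall>i\<in>I. \<pi> x i \<noteq> i"
    using assms unfolding full_propelinear_def I_def [symmetric] by blast
  have perm: "\<pi> x permutes I" and img: "star F v \<pi> x ` C = C" if "x \<in> C" for x
    using \<pi>(1,2) that by blast+
  have comp: "\<pi> (star F v \<pi> x y) = \<pi> x \<circ> \<pi> y" if "x \<in> C" "y \<in> C" for x y
    using \<pi>(3) that by blast
  have const: "x \<in> const_words F v \<Longrightarrow> \<pi> x = id"
    and nonconst: "x \<notin> const_words F v \<Longrightarrow> i \<in> I \<Longrightarrow> \<pi> x i \<noteq> i" if "x \<in> C" for x i
    using bspec [OF \<pi>(4) that] by simp_all
  \<comment> \<open>\<open>permute_word\<close> reads coordinate j at its preimage under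
    \<open>\<pi> x\<close>, so the inverse takes the role of the column permutation.\<close>
  define \<beta> where "\<beta> x = inv_into UNIV (\<pi> x)" for x
  have \<beta>: "\<beta> x permutes I" if "x \<in> C" for x
    using perm [OF that] by (simp add: \<beta>_def permutes_inv)
  have \<beta>I: "\<beta> x j \<in> I" if "x \<in> C" "j \<in> I" for x j
    using \<beta> that by (simp add: permutes_in_image)
  have star: "star F v \<pi> x y = (\<lambda>j\<in>I. x j \<oplus> y (\<beta> x j))" for x y
    by (simp add: star_eq \<beta>_def)
  have star_closed: "star F v \<pi> x y \<in> C" if "x \<in> C" "y \<in> C" for x y
    using img that by blast
  \<comment> \<open>The sign is forced: an automorphism subtracts its column word, and x is to be
    added.\<close>
  define Q where "Q x = emon (\<beta> x) (\<lambda>j. \<ominus> x j)" for x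
  have "\<exists>g. g \<in> carrier (Aut K I M) \<and> snd g = Q x" if x: "x \<in> C" for x
  proof -
    have "\<exists>\<alpha> p. aut \<alpha> p (\<beta> x) (\<lambda>j. \<ominus> x j)"
      using x \<beta> [OF x] star_closed [OF x] unfolding star by (rule ex_aut_of_code_isometry)
    then show ?thesis using aut_in_Aut by (force simp: Q_def)
  qed
  \<comment> \<open>Row parts are chosen arbitrarily here; by \<open>Aut_eqI\<close> only one choice
    is possible.\<close>
  then obtain G where G: "\<And>x. x \<in> C \<Longrightarrow> G x \<in> carrier (Aut K I M)"
    and snd_G: "\<And>x. x \<in> C \<Longrightarrow> snd (G x) = Q x"
    by metis
  have neg_fn: "(\<lambda>j. \<ominus> x j) \<in> I \<rightarrow> carrier F" if "x \<in> C" for x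
    using that by simp
  have Q_eqD: "\<beta> x = \<beta>' \<and> (\<forall>j\<in>I. \<ominus> x j = r j)"
    if "x \<in> C" "Q x = emon \<beta>' r" "\<beta>' permutes I" "r \<in> I \<rightarrow> carrier F" for x \<beta>' r
    using that emon_eq_iff [OF \<beta> [OF that(1)] that(3) neg_fn [OF that(1)] that(4)] by (simp add: Q_def)
  have inj_G: "inj_on G C"
  proof (rule inj_onI)
    fix x y assume x: "x \<in> C" and y: "y \<in> C" and "G x = G y"
    then have "Q x = emon (\<beta> y) (\<lambda>j. \<ominus> y j)"
      using snd_G by (metis Q_def)
    then have "\<forall>j\<in>I. \<ominus> x j = \<ominus> y j"
      using Q_eqD x \<beta> [OF y] neg_fn [OF y] by blast
    then show "x = y"
      using x y by (metis code_eqI code_closed F.minus_minus)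
  qed
  interpret A: group "Aut K I M"
    by (rule group_Aut [OF group_K finite_I M_in_mats])
  let ?X = "expanded_mat K I M"
  have X: "?X \<in> mats E (carrier K)"
    by (rule expanded_mat_in_mats [OF group_K M_in_mats])
  have finite_E: "finite E" using finite_K by simp
  interpret PA: group "PAut K E ?X"
    by (rule group_PAut [OF group_K finite_E X])
  interpret \<Theta>: group_hom "Aut K I M" "PAut K E ?X" "Theta K I"
    using Theta_hom [OF comm_group_K finite_K finite_I M_in_mats] by unfold_locales
  let ?z = "const_word v \<zero>"
  have zero: "?z \<in> C" by (simp add: const_word_in_code)
  have G_zero: "G ?z = \<one>\<^bsub>Aut K I M\<^esub>"
  proof (rule Aut_eqI [OF G [OF zero] A.one_closed])
    have "\<beta> ?z = id" using const zero by (simp add: \<beta>_def const_words_def)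
    then show "snd (G ?z) = snd \<one>\<^bsub>Aut K I M\<^esub>"
      unfolding snd_G [OF zero] Q_def emon_def Aut_one
      by (auto simp: const_word_def I_def phi_zero intro!: mon_cong)
  qed
  have G_mult: "G x \<otimes>\<^bsub>Aut K I M\<^esub> G y = G (star F v \<pi> x y)" if x: "x \<in> C" and y: "y \<in> C" for x y
  proof (rule Aut_eqI [OF A.m_closed [OF G [OF x] G [OF y]] G [OF star_closed [OF x y]]])
    have "snd (G x \<otimes>\<^bsub>Aut K I M\<^esub> G y) = emon (\<beta> y \<circ> \<beta> x) (\<lambda>j. \<ominus> x j \<oplus> \<ominus> y (\<beta> x j))"
      using x y by (simp add: snd_Aut_mult snd_G Q_def emon_mult \<beta> neg_fn)
    also have "\<dots> = Q (star F v \<pi> x y)"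
    proof -
      \<comment> \<open>Inverting the composition law of \<pi> reverses the order, which matches the
        reversed composition in matrix products.\<close>
      have "\<beta> (star F v \<pi> x y) = \<beta> y \<circ> \<beta> x"
        using comp [OF x y] perm [OF x] perm [OF y]
        by (simp add: \<beta>_def o_inv_distrib permutes_bij)
      then show ?thesis
        using x y \<beta>I [OF x] by (auto simp: Q_def star F.minus_add intro!: emon_cong)
    qed
    finally show "snd (G x \<otimes>\<^bsub>Aut K I M\<^esub> G y) = snd (G (star F v \<pi> x y))"
      using x y by (simp add: snd_G star_closed)
  qed
  have sub: "subgroup (G ` C) (Aut K I M)"
  proof (rule A.subgroupI)
    show "G ` C \<subseteq> carrier (Aut K I M)" using G by blast
    show "G ` C \<noteq> {}" using zero by blast
    fix g assume "g \<in> G ` C"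
    then obtain x where x: "x \<in> C" "g = G x" by blast
    \<comment> \<open>Star by x maps the code onto itself, so the zero word is attained; its
      preimage supplies the inverse.\<close>
    obtain y where y: "y \<in> C" "star F v \<pi> x y = ?z"
      using img [OF x(1)] zero by (metis imageE)
    have "G x \<otimes>\<^bsub>Aut K I M\<^esub> G y = \<one>\<^bsub>Aut K I M\<^esub>"
      using G_mult x y G_zero by simp
    then have "inv\<^bsub>Aut K I M\<^esub> g = G y"
      using A.inv_equality A.inv_comm G x y by metis
    then show "inv\<^bsub>Aut K I M\<^esub> g \<in> G ` C" using y by simp
    fix h assume "h \<in> G ` C"
    then show "g \<otimes>\<^bsub>Aut K I M\<^esub> h \<in> G ` C"
      using G_mult star_closed x by auto
  qed
  have scalars: "scalar_pairs K I \<subseteq> G ` C"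
  proof
    fix g assume "g \<in> scalar_pairs K I"
    then obtain c where c: "c \<in> carrier F" and g: "g = (emon id (\<lambda>_. c), emon id (\<lambda>_. c))"
      by (auto simp: scalar_pairs_eq)
    \<comment> \<open>The scalar pair of c subtracts c, so it sends the zero word to this
      one.\<close>
    let ?x = "const_word v (\<ominus> c)"
    have x: "?x \<in> C" using c by (simp add: const_word_in_code)
    have "\<beta> ?x = id" using const [OF x] c by (simp add: \<beta>_def const_words_def)
    then have "snd g = snd (G ?x)"
      unfolding snd_G [OF x] Q_def g using c by (auto simp: const_word_def I_def intro!: emon_cong)
    then have "g = G ?x"
      using Aut_eqI aut_in_Aut [OF aut_scalar [OF c]] G [OF x] g by blast
    then show "g \<in> G ` C" using x by simp
  qed
  have one: "Theta K I (G x) = \<one>\<^bsub>PAut K E ?X\<^esub>" if x: "x \<in> C" and "\<And>j. j \<in> I \<Longrightarrow> x j = \<zero>" for x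
  proof -
    have "x = ?z"
      using that by (intro code_eqI [OF x zero]) (simp add: const_word_def I_def)
    then show ?thesis by (simp add: G_zero)
  qed
  have G_emonE: "\<exists>\<alpha> p r. aut \<alpha> p (\<beta> x) r \<and> (\<forall>j\<in>I. \<ominus> r j = x j) \<and> G x = (emon \<alpha> p, emon (\<beta> x) r)"
    if x: "x \<in> C" for x
  proof -
    obtain \<alpha> p \<beta>' r where a: "aut \<alpha> p \<beta>' r" and g: "G x = (emon \<alpha> p, emon \<beta>' r)"
      using G [OF x] by (rule Aut_emonE)
    have "\<beta> x = \<beta>' \<and> (\<forall>j\<in>I. \<ominus> x j = r j)"
      using Q_eqD [OF x, of \<beta>' r] snd_G [OF x] a g by (simp add: aut_def)
    then show ?thesis using a g x by (metis F.minus_minus code_closed)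
  qed
  have "regular_subgroup K E ?X (Theta K I ` G ` C)"
  proof (rule regular_subgroupI_card [OF group_K finite_E X])
    show "subgroup (Theta K I ` G ` C) (PAut K E ?X)"
      using sub by (rule \<Theta>.subgroup_img_is_subgroup)
    have "inj_on (Theta K I) (G ` C)"
      by (rule inj_on_subset [OF Theta_inj [OF group_K]]) (use G in blast)
    then show "card (Theta K I ` G ` C) = card E"
      by (simp add: card_image inj_G card_code)
  next
    fix g e assume "g \<in> Theta K I ` G ` C" and e: "e \<in> E" and fix_e: "perm_of K E (fst g) e = e"
    then obtain x where x: "x \<in> C" and g: "g = Theta K I (G x)" by blast
    obtain \<alpha> p r where a: "aut \<alpha> p (\<beta> x) r" and r: "\<And>j. j \<in> I \<Longrightarrow> \<ominus> r j = x j"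
      and G_eq: "G x = (emon \<alpha> p, emon (\<beta> x) r)"
      using G_emonE [OF x] by blast
    obtain c i where c: "c \<in> carrier F" and i: "i \<in> I" and e_eq: "e = (\<phi> c, i)"
      using e by (rule expanded_indexE)
    have p: "p i \<in> carrier F" using a i by (auto simp: aut_def)
    have "\<alpha> i = i" "c \<oplus> p i = c"
      using fix_e Theta_rows [OF a c c i i] by (simp_all add: g G_eq e_eq)
    then have "\<alpha> i = i" "p i = \<zero>" using c p by simp_all
    then have fixed: "x j \<oplus> cw c i (\<beta> x j) = cw c i j" if "j \<in> I" for j
      using aut_cw [OF a c i that] r [OF that] c by (simp add: F.minus_eq)
    \<comment> \<open>A fixed row is a codeword w with x \<star> w = w. The composition law then
      lets the permutation of w be cancelled, so \<open>\<pi> x\<close> is the identity; what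
      remains is x + w = w, hence x = 0.\<close>
    then have "star F v \<pi> x (cw c i) = cw c i"
      unfolding star by (auto simp: cw_def)
    then have "\<pi> x \<circ> \<pi> (cw c i) = \<pi> (cw c i)"
      using comp [OF x cw_in_code [OF c i]] by simp
    then have "\<pi> x = id"
      using permutes_surj [OF perm [OF cw_in_code [OF c i]]] by (metis fun.map_id surj_fun_eq id_comp)
    show "g = \<one>\<^bsub>PAut K E ?X\<^esub>"
      unfolding g
    proof (rule one [OF x])
      fix j assume j: "j \<in> I"
      have "x j \<oplus> cw c i j = cw c i j"
        using fixed [OF j] \<open>\<pi> x = id\<close> by (simp add: \<beta>_def)
      then show "x j = \<zero>" using x c i j by simp
    qed
  next
    fix g e assume "g \<in> Theta K I ` G ` C" and e: "e \<in> E" and fix_e: "perm_of K E (snd g) e = e"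
    then obtain x where x: "x \<in> C" and g: "g = Theta K I (G x)" by blast
    obtain \<alpha> p r where a: "aut \<alpha> p (\<beta> x) r" and r: "\<And>j. j \<in> I \<Longrightarrow> \<ominus> r j = x j"
      and G_eq: "G x = (emon \<alpha> p, emon (\<beta> x) r)"
      using G_emonE [OF x] by blast
    obtain c i where c: "c \<in> carrier F" and i: "i \<in> I" and e_eq: "e = (\<phi> c, i)"
      using e by (rule expanded_indexE)
    have ri: "r i \<in> carrier F" using a i by (auto simp: aut_def)
    have "\<beta> x i = i" "c \<oplus> r i = c"
      using fix_e Theta_cols [OF a c c i i] by (simp_all add: g G_eq e_eq)
    \<comment> \<open>A fixed column yields a coordinate that \<open>\<pi> x\<close> fixes and at
      which x vanishes. The first forces x to be constant, the second makes the constant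
      zero.\<close>
    then have "\<pi> x i = i" "x i = \<zero>"
      using c ri r [OF i] permutes_inverses(1) [OF perm [OF x], of i] by (simp_all add: \<beta>_def)
    then obtain d where "d \<in> carrier F" "x = const_word v d"
      using nonconst [OF x _ i] by (auto simp: const_words_def)
    with \<open>x i = \<zero>\<close> i have "x j = \<zero>" if "j \<in> I" for j
      using that by (simp add: const_word_def I_def)
    then show "g = \<one>\<^bsub>PAut K E ?X\<^esub>"
      unfolding g by (rule one [OF x])
  qed
  then show ?thesis using sub scalars by blast
qed

text \<open>The two actions play different parts. Regularity on rows attaches to each codeword
  exactly one element of R, which defines \<pi> and gives its composition law; freeness on columns
  excludes fixed coordinates for nonconstant words.\<close>

lemma regular_imp_propelinear:
  assumes R: "subgroup R (Aut K I M)" and scalars: "scalar_pairs K I \<subseteq> R"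
    and reg: "regular_subgroup K E (expanded_mat K I M) (Theta K I ` R)"
  shows "full_propelinear F v C"
proof -
  let ?X = "expanded_mat K I M"
  let ?S = "PAut K E ?X\<lparr>carrier := Theta K I ` R\<rparr>"
  interpret R: subgroup R "Aut K I M" by fact
  have rows: "regular_action ?S E (\<lambda>(P, Q). perm_of K E P)"
    and cols: "regular_action ?S E (\<lambda>(P, Q). perm_of K E Q)"
    using reg by (simp_all add: regular_subgroup_def)
  have Theta_eqD: "g = h" if "Theta K I g = Theta K I h" "g \<in> R" "h \<in> R" for g h
    using inj_onD [OF Theta_inj [OF group_K]] that R.subset by blast
  define D where "D \<alpha> p \<beta> r \<longleftrightarrow> aut \<alpha> p \<beta> r \<and> (emon \<alpha> p, emon \<beta> r) \<in> R" for \<alpha> p \<beta> r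
  have D_rows: "(emon \<alpha> p, emon \<beta> r) = (emon \<alpha>' p', emon \<beta>' r')"
    if D: "D \<alpha> p \<beta> r" "D \<alpha>' p' \<beta>' r'" and i: "i \<in> I" "\<alpha> i = 1" "\<alpha>' i = 1" "p i = p' i"
    for \<alpha> p \<beta> r \<alpha>' p' \<beta>' r' i
  proof (rule Theta_eqD)
    have a: "aut \<alpha> p \<beta> r" "aut \<alpha>' p' \<beta>' r'" using D by (simp_all add: D_def)
    have p: "p i \<in> carrier F" using a i by (auto simp: aut_def)
    \<comment> \<open>The row \<open>(\<phi> \<zero>, 1)\<close>, the label of the zero word, goes
      to row i shifted by the negative of \<open>p i\<close>. So i and \<open>p i\<close> already
      decide the element of R.\<close>
    have "perm_of K E (fst (Theta K I (emon \<alpha> p, emon \<beta> r))) (\<phi> \<zero>, 1) = (\<phi> (\<ominus> p i), i)"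
      using Theta_rows [OF a(1) F.zero_closed F.a_inv_closed [OF p] one_in_I i(1)] i p
      by (simp add: F.l_neg)
    moreover have "perm_of K E (fst (Theta K I (emon \<alpha>' p', emon \<beta>' r'))) (\<phi> \<zero>, 1) = (\<phi> (\<ominus> p i), i)"
      using Theta_rows [OF a(2) F.zero_closed F.a_inv_closed [OF p] one_in_I i(1)] i p
      by (simp add: F.l_neg)
    ultimately show "Theta K I (emon \<alpha> p, emon \<beta> r) = Theta K I (emon \<alpha>' p', emon \<beta>' r')"
      using D one_in_I
      by (intro regular_actionD [OF rows, where x = "(\<phi> \<zero>, 1)"]) (auto simp: D_def case_prod_beta)
  qed (use D in \<open>simp_all add: D_def\<close>)
  \<comment> \<open>The image of the zero word is computed twice: from the column data it is -r,
    from the row data a shifted row.\<close>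
  have D_word: "(\<lambda>j\<in>I. \<ominus> r j) = cw (\<ominus> p i) i" if D: "D \<alpha> p \<beta> r" and i: "i \<in> I" "\<alpha> i = 1" for \<alpha> p \<beta> r i
  proof
    fix j
    have a: "aut \<alpha> p \<beta> r" using D by (simp add: D_def)
    show "(\<lambda>j\<in>I. \<ominus> r j) j = cw (\<ominus> p i) i j"
    proof (cases "j \<in> I")
      case True
      then have "\<beta> j \<in> I" "p i \<in> carrier F" "r j \<in> carrier F"
        using a i by (auto simp: aut_def permutes_in_image)
      then show ?thesis
        using aut_cw [OF a F.zero_closed i(1) True] True i
        by (simp add: H_one F.minus_eq del: One_nat_def)
    qed (simp add: cw_def)
  qed
  have D_base: "\<exists>i\<in>I. \<alpha> i = 1" if "D \<alpha> p \<beta> r" for \<alpha> p \<beta> r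
  proof -
    have "\<alpha> permutes I" using that by (simp add: D_def aut_def)
    then show ?thesis using one_in_I by (metis imageE permutes_image)
  qed
  \<comment> \<open>By \<open>D_word\<close> the word -r determines i and \<open>p i\<close>, hence
    the element of R. This uniqueness carries the composition law and the treatment of constant
    words.\<close>
  have D_unique: "(emon \<alpha> p, emon \<beta> r) = (emon \<alpha>' p', emon \<beta>' r')"
    if D: "D \<alpha> p \<beta> r" "D \<alpha>' p' \<beta>' r'" and eq: "\<And>j. j \<in> I \<Longrightarrow> \<ominus> r j = \<ominus> r' j"
    for \<alpha> p \<beta> r \<alpha>' p' \<beta>' r'
  proof -
    obtain i where i: "i \<in> I" "\<alpha> i = 1" using D_base [OF D(1)] by blast
    obtain i' where i': "i' \<in> I" "\<alpha>' i' = 1" using D_base [OF D(2)] by blast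
    have p: "p i \<in> carrier F" "p' i' \<in> carrier F"
      using D i i' by (auto simp: D_def aut_def)
    have "cw (\<ominus> p i) i = cw (\<ominus> p' i') i'"
      unfolding D_word [OF D(1) i, symmetric] D_word [OF D(2) i', symmetric]
      using eq by (intro restrict_ext)
    then have "\<ominus> p i = \<ominus> p' i' \<and> i = i'"
      using cw_eq_iff [OF F.a_inv_closed [OF p(1)] F.a_inv_closed [OF p(2)] i(1) i'(1)] by blast
    then show ?thesis
      using D_rows [OF D i] i' p by (metis F.minus_minus)
  qed
  have D_unique_perm: "\<beta> = \<beta>'"
    if D: "D \<alpha> p \<beta> r" "D \<alpha>' p' \<beta>' r'" and eq: "\<And>j. j \<in> I \<Longrightarrow> \<ominus> r j = \<ominus> r' j"
    for \<alpha> p \<beta> r \<alpha>' p' \<beta>' r'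
    using D_unique [OF that] D emon_eq_iff [of \<beta> \<beta>' r r'] by (simp add: D_def aut_def)
  have "\<exists>\<alpha> p \<beta> r. D \<alpha> p \<beta> r \<and> (\<forall>j\<in>I. \<ominus> r j = x j)" if xC: "x \<in> C" for x
  proof -
    obtain a i where a: "a \<in> carrier F" and i: "i \<in> I" and x: "x = cw a i"
      using xC by (auto simp: code_eq)
    \<comment> \<open>Transitivity on rows moves the label of the zero word to the label of
      x.\<close>
    have "\<exists>g\<in>carrier ?S. (\<lambda>(P, Q). perm_of K E P) g (\<phi> \<zero>, 1) = (\<phi> a, i)"
      using rows a i one_in_I
      by (intro transitive_action.unique_orbit) (auto simp: regular_action_def)
    then obtain g where g: "g \<in> R" "perm_of K E (fst (Theta K I g)) (\<phi> \<zero>, 1) = (\<phi> a, i)"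
      by (auto simp: case_prod_beta)
    obtain \<alpha> p \<beta> r where aut: "aut \<alpha> p \<beta> r" and g_eq: "g = (emon \<alpha> p, emon \<beta> r)"
      using R.subset g(1) by (blast elim: Aut_emonE)
    have D: "D \<alpha> p \<beta> r" using aut g g_eq by (simp add: D_def)
    have p: "p i \<in> carrier F" using aut i by (auto simp: aut_def)
    have \<alpha>: "\<alpha> i = 1" and "a \<oplus> p i = \<zero>"
      using g(2) Theta_rows [OF aut F.zero_closed a one_in_I i] by (simp_all add: g_eq)
    then have "a = \<ominus> p i" using F.minus_equality [of a "p i"] a p by simp
    then have "(\<lambda>j\<in>I. \<ominus> r j) = x" using D_word [OF D i \<alpha>] x by simp
    then show ?thesis using D by (metis restrict_apply')
  qed
  \<comment> \<open>The permutations and words of the element chosen for x; its column word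
    \<open>Z x\<close> is -x on \<open>I\<close>.\<close>
  then obtain A P B Z where D: "\<And>x. x \<in> C \<Longrightarrow> D (A x) (P x) (B x) (Z x)"
    and Z: "\<And>x j. x \<in> C \<Longrightarrow> j \<in> I \<Longrightarrow> \<ominus> Z x j = x j"
    by metis
  have aut: "aut (A x) (P x) (B x) (Z x)" if "x \<in> C" for x
    using D [OF that] by (simp add: D_def)
  have B: "B x permutes I" if "x \<in> C" for x
    using aut [OF that] by (simp add: aut_def)
  define \<pi> where "\<pi> x = inv_into UNIV (B x)" for x
  have \<pi>: "\<pi> x permutes I" and inv_\<pi>: "inv_into UNIV (\<pi> x) = B x" if "x \<in> C" for x
    using B [OF that] by (simp_all add: \<pi>_def permutes_inv permutes_inv_inv)
  have star: "star F v \<pi> x y = (\<lambda>j\<in>I. x j \<oplus> y (B x j))" if "x \<in> C" for x y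
    using inv_\<pi> [OF that] by (simp add: star_eq)
  \<comment> \<open>Star by x is the action of the chosen element on codewords, so bijectivity of
    \<open>A x\<close> makes it preserve the code.\<close>
  have star_cw: "star F v \<pi> x (cw a (A x i)) = cw (a \<ominus> P x i) i"
    if x: "x \<in> C" and a: "a \<in> carrier F" and i: "i \<in> I" for x a i
    unfolding star [OF x] using aut_cw [OF aut [OF x] a i] Z [OF x] by (auto simp: cw_def)
  have A_bij: "A x ` I = I" and P: "\<And>i. i \<in> I \<Longrightarrow> P x i \<in> carrier F" if "x \<in> C" for x
    using aut [OF that] by (auto simp: aut_def permutes_image)
  have img: "star F v \<pi> x ` C = C" if x: "x \<in> C" for x
  proof
    show "star F v \<pi> x ` C \<subseteq> C"
    proof clarify
      fix y assume "y \<in> C"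
      then obtain a k where "a \<in> carrier F" "k \<in> I" "y = cw a k" by (auto simp: code_eq)
      moreover obtain i where "i \<in> I" "k = A x i" using A_bij [OF x] \<open>k \<in> I\<close> by (metis imageE)
      ultimately show "star F v \<pi> x y \<in> C"
        using star_cw [OF x] P [OF x] by (simp add: cw_in_code)
    qed
    show "C \<subseteq> star F v \<pi> x ` C"
    proof
      fix y assume "y \<in> C"
      then obtain a i where a: "a \<in> carrier F" and i: "i \<in> I" and y: "y = cw a i" by (auto simp: code_eq)
      have "A x i \<in> I" using A_bij [OF x] i by blast
      moreover have "(a \<oplus> P x i) \<ominus> P x i = a"
        using a P [OF x i] by (simp add: F.minus_eq F.add.m_assoc F.r_neg)
      ultimately show "y \<in> star F v \<pi> x ` C"
        using star_cw [OF x F.add.m_closed [OF a P [OF x i]] i] a P [OF x i]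
        by (intro image_eqI [where x = "cw (a \<oplus> P x i) (A x i)"]) (auto simp: y)
    qed
  qed
  have comp: "\<pi> (star F v \<pi> x y) = \<pi> x \<circ> \<pi> y" if x: "x \<in> C" and y: "y \<in> C" for x y
  proof -
    have xy: "star F v \<pi> x y \<in> C" using img [OF x] y by blast
    have fn: "P x \<in> I \<rightarrow> carrier F" "Z x \<in> I \<rightarrow> carrier F" "A x permutes I" "B x permutes I"
      "P y \<in> I \<rightarrow> carrier F" "Z y \<in> I \<rightarrow> carrier F" "A y permutes I" "B y permutes I"
      using aut [OF x] aut [OF y] by (simp_all add: aut_def)
    \<comment> \<open>The data of the product of the elements chosen for x and y. The product lies
      in R and has column word -(x \<star> y), so it agrees with the element chosen for x \<star>
      y.\<close>
    let ?p = "\<lambda>i. P x i \<oplus> P y (A x i)" and ?r = "\<lambda>j. Z x j \<oplus> Z y (B x j)"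
    have BI: "B x j \<in> I" if "j \<in> I" for j using fn(4) that by (simp add: permutes_in_image)
    have AI: "A x j \<in> I" if "j \<in> I" for j using fn(3) that by (simp add: permutes_in_image)
    have "(emon (A x) (P x), emon (B x) (Z x)) \<otimes>\<^bsub>Aut K I M\<^esub> (emon (A y) (P y), emon (B y) (Z y)) \<in> R"
      using D [OF x] D [OF y] by (simp add: D_def)
    then have inR: "(emon (A y \<circ> A x) ?p, emon (B y \<circ> B x) ?r) \<in> R"
      using fn by (simp add: Aut_mult emon_mult)
    then have "(emon (A y \<circ> A x) ?p, emon (B y \<circ> B x) ?r) \<in> carrier (Aut K I M)"
      using R.subset by blast
    then have "aut (A y \<circ> A x) ?p (B y \<circ> B x) ?r"
      using fn AI BI by (subst (asm) emon_in_Aut_iff) (auto simp: Pi_def intro: permutes_compose)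
    then have "D (A y \<circ> A x) ?p (B y \<circ> B x) ?r"
      using inR by (simp add: D_def)
    then have "B (star F v \<pi> x y) = B y \<circ> B x"
    proof (rule D_unique_perm [OF D [OF xy]])
      fix j assume j: "j \<in> I"
      have "Z x j \<in> carrier F" "Z y (B x j) \<in> carrier F" using fn j BI by auto
      then show "\<ominus> Z (star F v \<pi> x y) j = \<ominus> (Z x j \<oplus> Z y (B x j))"
        using Z [OF xy j] Z [OF x j] Z [OF y BI [OF j]] j by (simp add: star [OF x] F.minus_add)
    qed
    then show ?thesis
      using fn by (simp add: \<pi>_def o_inv_distrib permutes_bij)
  qed
  \<comment> \<open>This is where the inclusion of the scalar pairs in R is used: they supply
    comparison elements with trivial permutations.\<close>
  have scalar_D: "D id (\<lambda>_. c) id (\<lambda>_. c)" if "c \<in> carrier F" for c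
    using that scalars aut_scalar by (auto simp: D_def scalar_pairs_eq)
  have const: "\<pi> x = id" if x: "x \<in> C" and xc: "x \<in> const_words F v" for x
  proof -
    obtain c where c: "c \<in> carrier F" "x = const_word v c"
      using xc by (auto simp: const_words_def)
    have "B x = id"
    proof (rule D_unique_perm [OF D [OF x] scalar_D])
      show "\<ominus> Z x j = \<ominus> (\<ominus> c)" if "j \<in> I" for j
        using Z [OF x that] that c by (simp add: const_word_def I_def)
    qed (use c in simp)
    then show ?thesis by (simp add: \<pi>_def)
  qed
  have nonconst: "\<pi> x i \<noteq> i" if x: "x \<in> C" and nc: "x \<notin> const_words F v" and i: "i \<in> I" for x i
  proof
    assume "\<pi> x i = i"
    then have Bi: "B x i = i"
      using B [OF x] by (metis \<pi>_def permutes_inverses(1))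
    \<comment> \<open>The value for which the scalar pair of c agrees with the element of x on
      column \<open>(\<phi> \<zero>, i)\<close>: both send it to \<open>(\<phi> c, i)\<close>.
      Freeness on columns makes them equal, so x is the constant -c.\<close>
    define c where "c = Z x i"
    have c: "c \<in> carrier F" using aut [OF x] i by (auto simp: aut_def c_def)
    let ?g = "(emon (A x) (P x), emon (B x) (Z x))" and ?h = "(emon id (\<lambda>_. c), emon id (\<lambda>_. c))"
    have gh: "?g \<in> R" "?h \<in> R" using D [OF x] scalar_D [OF c] by (simp_all add: D_def)
    have "perm_of K E (snd (Theta K I ?g)) (\<phi> \<zero>, i) = (\<phi> c, i)"
      using Theta_cols [OF aut [OF x] F.zero_closed c i i] Bi c by (simp add: c_def)
    moreover have "perm_of K E (snd (Theta K I ?h)) (\<phi> \<zero>, i) = (\<phi> c, i)"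
      using Theta_cols [OF aut_scalar [OF c] F.zero_closed c i i] c by simp
    ultimately have "Theta K I ?g = Theta K I ?h"
      using gh i by (intro regular_actionD [OF cols, where x = "(\<phi> \<zero>, i)"]) (auto simp: case_prod_beta)
    then have "?g = ?h" using gh by (rule Theta_eqD)
    then have Zc: "\<forall>j\<in>I. Z x j = c"
      using emon_eq_iff [of "B x" id "Z x" "\<lambda>_. c"] aut [OF x] c by (simp add: aut_def)
    have "x = const_word v (\<ominus> c)"
    proof (rule code_eqI [OF x const_word_in_code])
      show "x j = const_word v (\<ominus> c) j" if "j \<in> I" for j
        using Z [OF x that] Zc that by (simp add: const_word_def I_def)
    qed (use c in simp)
    then show False using nc c by (auto simp: const_words_def)
  qed
  show ?thesis
    unfolding full_propelinear_def I_def [symmetric]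
    using code_in_words const_word_in_code [OF F.zero_closed] \<pi> img comp const nonconst
    by (intro conjI exI [of _ \<pi>]) auto
qed

end

theorem theorem3p3:
  fixes F :: "('a, 'm) ring_scheme" and K :: "('k, 'n) monoid_scheme"
    and q v :: nat and H :: "nat \<times> nat \<Rightarrow> 'a" and \<phi> :: "'a \<Rightarrow> 'k"
  assumes "primepow q" and "field F" and "order F = q"
    and "gen_hadamard F v H" and "normalized F v H"
    and "group K" and "\<phi> \<in> iso (add_monoid F) K"
  shows "GHFP_code F v (gh_code F v H) \<longleftrightarrow>
    (\<exists>R. subgroup R (Aut K {1..v} (map_mat {1..v} \<phi> H)) \<and>
         scalar_pairs K {1..v} \<subseteq> R \<and>
         regular_subgroup K (carrier K \<times> {1..v})
           (expanded_mat K {1..v} (map_mat {1..v} \<phi> H)) (Theta K {1..v} ` R) \<and>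
         Theta K {1..v} ` scalar_pairs K {1..v} \<subseteq> Theta K {1..v} ` R)"
proof -
  \<comment> \<open>The order of an infinite carrier is 0, which is not a prime power.\<close>
  have "finite (carrier F)"
    using primepow_gt_0_nat [OF assms(1)] assms(3) by (auto simp: order_def card_gt_0_iff)
  then interpret gh_matrix F K v H \<phi>
    using assms by (intro gh_matrix.intro)
  \<comment> \<open>The matrix \<open>H\<close> itself witnesses that its code is a generalized
    Hadamard code, so only the propelinear condition remains.\<close>
  have "GHFP_code F v C \<longleftrightarrow> full_propelinear F v C"
    using gh by (auto simp: GHFP_code_def)
  then show ?thesis
    unfolding I_def [symmetric]
    using propelinear_imp_regular regular_imp_propelinear by (metis image_mono)
qed

end
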